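(* Let $d\in\mathbb{N}$, $d\ge2$, $\beta>d/2$ and $L\in(0,\infty)$. Then there is a constant $C(L,\beta,d)>0$, depending only on $L,\beta,d$, such that for every $n\in\mathbb{N}$, $n\ge1$, and every $x\in\mathbb{R}^d$, with $m_o:=n^{1/(2\beta+d-1)}$, $$\sup_{f\in\mathcal{W}^\beta(L)}\mathbb{E}_{\mathcal{R}[f]}\left[\left|\widehat f_{m_o}(x)-f(x)\right|^2\right]\le C(L,\beta,d)\,n^{-\frac{2\beta-d}{2\beta+d-1}},$$ where the supremum is over all probability densities $f$ on $\mathbb{R}^d$ belonging to $\mathcal{W}^\beta(L)$.
   Context: $\|\cdot\|$ and $\langle\cdot,\cdot\rangle$ are the Euclidean norm and scalar product, $\mathbb{S}^{d-1}$ is the unit sphere of $\mathbb{R}^d$ with surface measure $\sigma^{d-1}$, and $\rho_d:=2\pi^{d/2}/\Gamma(d/2)$ is its total surface measure. $\lambda^d$ is Lebesgue measure on $\mathbb{R}^d$. Radon transform: for $h\in L^1(\mathbb{R}^d)$ and $(s,u)\in\mathbb{S}^{d-1}\times\mathbb{R}$, $\mathcal{R}[h](s,u):=\int_{\{v\in\mathbb{R}^d:\langle v,s\rangle=u\}}h(v)\,dv$, integration being with respect to the hypersurface ($(d-1)$-dimensional Lebesgue) measure on the hyperplane. For a probability density $f$, $\rho_d^{-1}\mathcal{R}[f]$ is a probability density on $\mathbb{S}^{d-1}\times\mathbb{R}$ with respect to $\sigma^{d-1}\otimes\lambda^1$. The observations $(S_1,U_1),\dots,(S_n,U_n)$ are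 i.i.d. with this density, and $\mathbb{E}_{\mathcal{R}[f]}$ denotes the corresponding expectation. Fourier transform: $\mathcal{F}_d[h](t):=\int_{\mathbb{R}^d}e^{i\langle t,y\rangle}h(y)\,d\lambda^d(y)$ (extended to $L^2(\mathbb{R}^d)$ as usual). A density $f$ with $\mathcal{F}_d[f]\in L^1(\mathbb{R}^d)$ (which holds for $f\in\mathcal{W}^\beta(L)$ with $\beta>d/2$) is identified with its continuous version, so that $f(x)$ is well defined. Sobolev ellipsoid: $\mathcal{W}^\beta(L):=\{f\in L^2(\mathbb{R}^d):\int_{\mathbb{R}^d}(1+\|t\|^2)^\beta|\mathcal{F}_d[f](t)|^2\,d\lambda^d(t)\le L\}$. Estimator: for $m\in(0,\infty)$ and $x\in\mathbb{R}^d$, $\widehat f_m(x):=\frac1n\sum_{i=1}^nK_m(\langle S_i,x\rangle-U_i)$ with $K_m(u):=\frac{\rho_d}{(2\pi)^d}\int_0^m r^{d-1}\cos(ur)\,dr$, $u\in\mathbb{R}$. *)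

theory Defs
  imports "HOL-Probability.Probability"
begin

section \<open>Measures on the sphere and on hyperplanes\<close>

definition rho :: "nat \<Rightarrow> real" where
  "rho d = 2 * pi powr (real d / 2) / Gamma (real d / 2)"

text \<open>Surface measure of the unit sphere: the surface measure of \<open>A\<close> is \<open>d\<close> times the volume
  of the cone \<open>{r *\<^sub>R s | 0 < r < 1, s \<in> A}\<close>.  It lives on the sphere itself, not on the
  ambient space.\<close>

definition sphere_measure :: "(real ^ 'd::finite) measure" where
  "sphere_measure =
     scale_measure (of_nat CARD('d))
       (distr (restrict_space lborel (ball 0 1 - {0}))
              (restrict_space borel (sphere 0 1))
              (\<lambda>x. x /\<^sub>R norm x))"

text \<open>\<open>hyperplane_measure s u\<close> is only meaningful for unit vectors \<open>s\<close>: the hyperplane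
  \<open>{v. v \<bullet> s = u}\<close> is then \<open>u *\<^sub>R s\<close> plus the orthogonal complement of \<open>s\<close>, and its
  \<open>(d-1)\<close>-dimensional Lebesgue measure is the image of the product Lebesgue measure under
  orthonormal coordinates.  By rotation invariance it does not depend on the chosen basis.\<close>

definition hyperplane_basis :: "real ^ 'd::finite \<Rightarrow> (real ^ 'd) set" where
  "hyperplane_basis s =
     (SOME B. pairwise orthogonal B \<and> (\<forall>b\<in>B. norm b = 1) \<and> span B = {v. v \<bullet> s = 0})"

definition hyperplane_measure :: "real ^ 'd::finite \<Rightarrow> real \<Rightarrow> (real ^ 'd) measure" where
  "hyperplane_measure s u =
     distr (\<Pi>\<^sub>M b\<in>hyperplane_basis s. lborel) borel
       (\<lambda>y. u *\<^sub>R s + (\<Sum>b\<in>hyperplane_basis s. y b *\<^sub>R b))"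

lemma hyperplane_basis:
  fixes s :: "real ^ 'd::finite"
  shows "pairwise orthogonal (hyperplane_basis s)"
    and "\<And>b. b \<in> hyperplane_basis s \<Longrightarrow> norm b = 1"
    and "span (hyperplane_basis s) = {v. v \<bullet> s = 0}"
proof -
  have "subspace {v. v \<bullet> s = 0}"
    by (simp add: subspace_def inner_add_left)
  then have "\<exists>B. pairwise orthogonal B \<and> (\<forall>b\<in>B. norm b = 1) \<and> span B = {v. v \<bullet> s = 0}"
    by (rule orthonormal_basis_subspace) blast
  from someI_ex[OF this] show "pairwise orthogonal (hyperplane_basis s)"
    and "\<And>b. b \<in> hyperplane_basis s \<Longrightarrow> norm b = 1"
    and "span (hyperplane_basis s) = {v. v \<bullet> s = 0}"
    by (auto simp: hyperplane_basis_def)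
qed

lemma emeasure_sphere_measure:
  fixes A :: "(real ^ 'd::finite) set"
  assumes "A \<in> sets borel" "A \<subseteq> sphere 0 1"
  shows "emeasure sphere_measure A =
    of_nat CARD('d) * emeasure lborel {x. x \<noteq> 0 \<and> norm x < 1 \<and> x /\<^sub>R norm x \<in> A}"
proof -
  have [measurable]: "(\<lambda>x::real^'d. x /\<^sub>R norm x)
      \<in> restrict_space lborel (ball 0 1 - {0}) \<rightarrow>\<^sub>M restrict_space borel (sphere 0 1)"
    by (rule measurable_restrict_space2) (auto simp: space_restrict_space intro: measurable_restrict_space1)
  have A: "A \<in> sets (restrict_space borel (sphere 0 1))"
    using assms by (auto simp: sets_restrict_space_iff)
  have eq: "(\<lambda>x. x /\<^sub>R norm x) -` A \<inter> (ball 0 1 - {0})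
      = {x. x \<noteq> 0 \<and> norm x < 1 \<and> x /\<^sub>R norm x \<in> A}"
    by auto
  show ?thesis
    unfolding sphere_measure_def emeasure_scale_measure
    using A by (subst emeasure_distr) (simp_all add: space_restrict_space eq, subst emeasure_restrict_space, auto)
qed

lemma unit_ball_vol_rho:
  assumes "d > 0"
  shows "real d * unit_ball_vol (real d) = rho d"
proof -
  have "real d / 2 \<notin> \<int>\<^sub>\<le>\<^sub>0"
    using assms nonpos_Ints_nonpos by force
  from Gamma_plus1[OF this]
  have G: "Gamma (real d / 2 + 1) = real d / 2 * Gamma (real d / 2)" .
  show ?thesis
    unfolding rho_def unit_ball_vol_def G using assms by simp
qed

lemma emeasure_sphere_measure_space:
  "emeasure (sphere_measure :: (real ^ 'd::finite) measure) (sphere 0 1) = ennreal (rho CARD('d))"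
proof -
  have "emeasure sphere_measure (sphere (0::real^'d) 1) =
      of_nat CARD('d) * emeasure lborel
        {x::real^'d. x \<noteq> 0 \<and> norm x < 1 \<and> x /\<^sub>R norm x \<in> sphere 0 1}"
    by (rule emeasure_sphere_measure) auto
  also have "{x::real^'d. x \<noteq> 0 \<and> norm x < 1 \<and> x /\<^sub>R norm x \<in> sphere 0 1} = ball 0 1 - {0}"
    by auto
  also have "emeasure lborel (ball 0 1 - {0::real^'d}) = emeasure lborel (ball 0 1 :: (real^'d) set)"
    by (subst emeasure_Diff) auto
  also have "of_nat CARD('d) * emeasure lborel (ball 0 1 :: (real^'d) set) = ennreal (rho CARD('d))"
    using unit_ball_vol_rho[of "CARD('d)", symmetric]
    by (simp add: emeasure_ball ennreal_mult' ennreal_of_nat_eq_real_of_nat)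
  finally show ?thesis .
qed

section \<open>Radon transform and Fourier transform\<close>

definition radon :: "(real ^ 'd::finite \<Rightarrow> real) \<Rightarrow> real ^ 'd \<Rightarrow> real \<Rightarrow> real" where
  "radon h s u = (LINT v|hyperplane_measure s u. h v)"

definition fourier :: "(real ^ 'd::finite \<Rightarrow> complex) \<Rightarrow> real ^ 'd \<Rightarrow> complex" where
  "fourier h t = (LINT y|lborel. exp (\<i> * complex_of_real (t \<bullet> y)) * h y)"

definition L2 :: "(real ^ 'd::finite \<Rightarrow> complex) set" where
  "L2 = {h. h \<in> borel_measurable borel \<and> integrable lborel (\<lambda>y. (cmod (h y))\<^sup>2)}"

text \<open>\<open>is_fourier_L2 h g\<close>: \<open>g\<close> is (a version of) the Fourier transform of \<open>h \<in> L2\<close>, i.e. the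
  mean-square limit of the Fourier integrals of the truncations of \<open>h\<close> to balls.\<close>

definition is_fourier_L2 ::
    "(real ^ 'd::finite \<Rightarrow> complex) \<Rightarrow> (real ^ 'd \<Rightarrow> complex) \<Rightarrow> bool" where
  "is_fourier_L2 h g \<longleftrightarrow> h \<in> L2 \<and> g \<in> L2 \<and>
     ((\<lambda>R. \<integral>\<^sup>+t. ennreal ((cmod (fourier (\<lambda>y. indicator (cball 0 R) y *\<^sub>R h y) t - g t))\<^sup>2) \<partial>lborel)
        \<longlongrightarrow> 0) at_top"

definition sobolev_ellipsoid :: "real \<Rightarrow> real \<Rightarrow> (real ^ 'd::finite \<Rightarrow> complex) set" where
  "sobolev_ellipsoid \<beta> L =
     {f \<in> L2. \<exists>g. is_fourier_L2 f g \<and>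
        (\<integral>\<^sup>+t. ennreal ((1 + (norm t)\<^sup>2) powr \<beta> * (cmod (g t))\<^sup>2) \<partial>lborel) \<le> ennreal L}"

section \<open>Densities, observations and the estimator\<close>

definition prob_density :: "(real ^ 'd::finite \<Rightarrow> real) \<Rightarrow> bool" where
  "prob_density f \<longleftrightarrow> f \<in> borel_measurable borel \<and> (\<forall>y. 0 \<le> f y) \<and>
     (\<integral>\<^sup>+y. ennreal (f y) \<partial>lborel) = 1"

definition continuous_version :: "(real ^ 'd::finite \<Rightarrow> real) \<Rightarrow> real ^ 'd \<Rightarrow> real" where
  "continuous_version f = (THE g. continuous_on UNIV g \<and> (AE y in lborel. g y = f y))"

definition observation_law :: "(real ^ 'd::finite \<Rightarrow> real) \<Rightarrow> ((real ^ 'd) \<times> real) measure" where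
  "observation_law f =
     density (sphere_measure \<Otimes>\<^sub>M lborel) (\<lambda>(s, u). ennreal (radon f s u / rho CARD('d)))"

definition kernel :: "nat \<Rightarrow> real \<Rightarrow> real \<Rightarrow> real" where
  "kernel d m u = rho d / (2 * pi) ^ d * (LBINT r:{0..m}. r ^ (d - 1) * cos (u * r))"

text \<open>The sample is \<open>\<omega> 1, \<dots>, \<omega> n\<close> with \<open>\<omega> i = (S\<^sub>i, U\<^sub>i)\<close>.\<close>

definition estimator ::
    "nat \<Rightarrow> real \<Rightarrow> real ^ 'd::finite \<Rightarrow> (nat \<Rightarrow> (real ^ 'd) \<times> real) \<Rightarrow> real" where
  "estimator n m x \<omega> = 1 / real n * (\<Sum>i=1..n. kernel CARD('d) m (fst (\<omega> i) \<bullet> x - snd (\<omega> i)))"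

text \<open>Mean squared error at \<open>x\<close> under \<open>n\<close> i.i.d. observations, with values in \<open>[0, \<infinity>]\<close>.\<close>

definition mse :: "nat \<Rightarrow> real \<Rightarrow> real ^ 'd::finite \<Rightarrow> (real ^ 'd \<Rightarrow> real) \<Rightarrow> ennreal" where
  "mse n m x f =
     (\<integral>\<^sup>+\<omega>. ennreal (\<bar>estimator n m x \<omega> - continuous_version f x\<bar>\<^sup>2)
        \<partial>(\<Pi>\<^sub>M i\<in>{1..n}. observation_law f))"

end

theory Submission
  imports Defs
begin

text \<open>By Fubini over the hyperplanes orthogonal to \<open>s\<close>, an observation has the law of \<open>(S, \<langle>Y, S\<rangle>)\<close> with
  \<open>S\<close> uniform on the sphere and \<open>Y\<close> independent of \<open>S\<close> with density \<open>f\<close>.  Hence, in polar coordinates,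
  the expected estimator is the Fourier inversion integral of \<open>f\<close> cut off at radius \<open>m\<close>, and its bias
  is at most \<open>(2 * pi) powr (- d)\<close> times the integral of \<open>|F f|\<close> over \<open>norm t > m\<close>, which Cauchy-Schwarz against the
  Sobolev weight bounds by a multiple of \<open>m\<close> to the power \<open>(d - 2 \<beta>) / 2\<close>.

  For the variance, the squared kernel is a double integral of \<open>cos (w r) cos (w r')\<close> over \<open>[0, m]\<^sup>2\<close>,
  where \<open>w = \<langle>S, x - Y\<rangle>\<close>.  Averaging over \<open>Y\<close> turns the cosines into values of \<open>F f\<close> at \<open>(r + r') S\<close> and
  \<open>(r - r') S\<close>.  Integrating these along the line through \<open>S\<close> and over the sphere costs only the \<open>L\<^sup>1\<close>
  norm of \<open>F f\<close>, so the second moment is of order \<open>m\<close> to the power \<open>2 d - 1\<close>.  The choice of \<open>m\<close> balances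
  both terms.\<close>

section \<open>Lebesgue measure on hyperplanes\<close>

text \<open>The point \<open>x\<close> enters only through phases of modulus 1, while all estimates
  use the modulus of the characteristic function \<open>phi\<close> of \<open>f\<close>, its bound 1
  and the Sobolev bound; hence the constant is uniform in \<open>x\<close> and \<open>f\<close>.
  With p = 2 \<beta> - d the squared bias has order m^(-p) and the variance order m^(2d-1) / n. They
  agree when m^(2 \<beta> + d - 1) = n.

  Three notions of the statement resist direct calculation. The hyperplane measure rests on a basis
  chosen separately for each direction, which hides how it varies with \<open>s\<close>. The value
  of \<open>continuous_version\<close> is known only once Fourier inversion has produced a
  continuous version. Membership in the ellipsoid speaks of a mean-square Fourier transform,
  determined only up to null sets. Much of the work replaces these by explicit integrals.

  The condition \<beta> > d/2 acts through the integrability of the inverse Sobolev weight at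
  infinity. It makes \<open>phi\<close> integrable, on which inversion, bias and variance all
  rest.\<close>

lemma nn_integral_lborel_scaleR:
  fixes t :: "'a::euclidean_space"
  assumes [measurable]: "f \<in> borel_measurable borel" and "c \<noteq> 0"
  shows "(\<integral>\<^sup>+x. f x \<partial>lborel) = ennreal (\<bar>c\<bar> ^ DIM('a)) * (\<integral>\<^sup>+x. f (t + c *\<^sub>R x) \<partial>lborel)"
  by (subst lborel_affine[OF \<open>c \<noteq> 0\<close>, of t])
     (simp add: nn_integral_density nn_integral_distr nn_integral_cmult)

lemma nn_integral_lborel_translate:
  fixes t :: "'a::euclidean_space"
  assumes "f \<in> borel_measurable borel"
  shows "(\<integral>\<^sup>+x. f (x + t) \<partial>lborel) = (\<integral>\<^sup>+x. f x \<partial>lborel)"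
  using nn_integral_lborel_scaleR[OF assms, of 1 t] by (simp add: add.commute)

lemma nn_integral_lborel_reflect:
  fixes t :: "'a::euclidean_space"
  assumes "f \<in> borel_measurable borel"
  shows "(\<integral>\<^sup>+x. f (t - x) \<partial>lborel) = (\<integral>\<^sup>+x. f x \<partial>lborel)"
  using nn_integral_lborel_scaleR[OF assms, of "-1" t] by simp

text \<open>Uniqueness of Haar measure: integrate \<open>g x * indicator A (x - y)\<close> in both orders.\<close>

lemma lborel_eqI_translation_invariant:
  fixes M :: "'a::euclidean_space measure" and g :: "'a \<Rightarrow> ennreal"
  assumes sets[measurable_cong]: "sets M = sets borel" and "sigma_finite_measure M"
    and trans: "\<And>a. distr M borel (\<lambda>x. x + a) = M"
    and g[measurable]: "g \<in> borel_measurable borel"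
    and eq: "(\<integral>\<^sup>+x. g x \<partial>M) = (\<integral>\<^sup>+x. g x \<partial>lborel)"
    and "(\<integral>\<^sup>+x. g x \<partial>lborel) \<noteq> 0" "(\<integral>\<^sup>+x. g x \<partial>lborel) \<noteq> \<infinity>"
  shows "M = lborel"
proof (rule measure_eqI)
  interpret M: sigma_finite_measure M by fact
  interpret pair_sigma_finite M lborel by unfold_locales
  fix A assume "A \<in> sets M"
  then have [measurable]: "A \<in> sets borel" using sets by simp
  have tr: "(\<integral>\<^sup>+x. h (x + a) \<partial>M) = (\<integral>\<^sup>+x. h x \<partial>M)" if [measurable]: "h \<in> borel_measurable borel" for h a
    by (subst (2) trans[symmetric, of a]) (simp add: nn_integral_distr)
  have "(\<integral>\<^sup>+x. g x \<partial>lborel) * emeasure lborel A = (\<integral>\<^sup>+x. g x * emeasure lborel A \<partial>M)"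
    by (simp add: nn_integral_multc eq)
  also have "\<dots> = (\<integral>\<^sup>+x. \<integral>\<^sup>+y. g x * indicator A (x - y) \<partial>lborel \<partial>M)"
  proof (rule nn_integral_cong)
    fix x
    have "emeasure lborel A = (\<integral>\<^sup>+y. indicator A (x - y) \<partial>lborel)"
      using nn_integral_lborel_reflect[of "indicator A" x] by simp
    then show "g x * emeasure lborel A = (\<integral>\<^sup>+y. g x * indicator A (x - y) \<partial>lborel)"
      by (simp add: nn_integral_cmult)
  qed
  also have "\<dots> = (\<integral>\<^sup>+y. \<integral>\<^sup>+x. g x * indicator A (x - y) \<partial>M \<partial>lborel)"
    by (rule Fubini'[symmetric]) measurable
  also have "\<dots> = (\<integral>\<^sup>+y. \<integral>\<^sup>+x. g (x + y) * indicator A x \<partial>M \<partial>lborel)"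
  proof (rule nn_integral_cong)
    fix y
    show "(\<integral>\<^sup>+x. g x * indicator A (x - y) \<partial>M) = (\<integral>\<^sup>+x. g (x + y) * indicator A x \<partial>M)"
      by (subst tr[of _ y, symmetric]) simp_all
  qed
  also have "\<dots> = (\<integral>\<^sup>+x. \<integral>\<^sup>+y. g (x + y) * indicator A x \<partial>lborel \<partial>M)"
    by (rule Fubini') measurable
  also have "\<dots> = (\<integral>\<^sup>+x. (\<integral>\<^sup>+x. g x \<partial>lborel) * indicator A x \<partial>M)"
    using nn_integral_lborel_translate[OF g] by (simp add: nn_integral_multc add.commute)
  also have "\<dots> = (\<integral>\<^sup>+x. g x \<partial>lborel) * emeasure M A"
    by (simp add: nn_integral_cmult)
  finally show "emeasure M A = emeasure lborel A"
    using assms(6,7) by (simp add: ennreal_mult_cancel_left)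
qed (simp add: sets)

text \<open>Boxes determine the product measure, and on a box each side moves separately. The
  shifted point is cut back to \<open>I\<close> because elements of the product space are
  extensional functions.\<close>

lemma distr_PiM_lborel_shift:
  assumes "finite I"
  shows "distr (\<Pi>\<^sub>M i\<in>I. lborel) (\<Pi>\<^sub>M i\<in>I. lborel) (\<lambda>y. \<lambda>i\<in>I. y i + a i)
    = (\<Pi>\<^sub>M i\<in>I. (lborel :: real measure))"
proof -
  interpret product_sigma_finite "\<lambda>_. lborel :: real measure" by standard
  show ?thesis
  proof (rule PiM_eqI)
    fix A :: "_ \<Rightarrow> real set" assume A: "\<And>i. i \<in> I \<Longrightarrow> A i \<in> sets lborel"
    have m: "(\<lambda>y. \<lambda>i\<in>I. y i + a i) \<in> (\<Pi>\<^sub>M i\<in>I. lborel) \<rightarrow>\<^sub>M (\<Pi>\<^sub>M i\<in>I. (lborel :: real measure))"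
      by measurable
    have e: "(\<lambda>y. \<lambda>i\<in>I. y i + a i) -` Pi\<^sub>E I A \<inter> space (\<Pi>\<^sub>M i\<in>I. (lborel :: real measure))
        = Pi\<^sub>E I (\<lambda>i. (\<lambda>x. x + a i) -` A i)"
      by (auto simp: space_PiM PiE_iff)
    have A': "(\<lambda>x. x + a i) -` A i \<in> sets borel" if "i \<in> I" for i
      using measurable_sets[of "\<lambda>x. x + a i" borel borel "A i"] A[OF that] by simp
    have "emeasure lborel ((\<lambda>x. x + a i) -` A i) = emeasure lborel (A i)" if "i \<in> I" for i
    proof -
      have [measurable]: "A i \<in> sets borel" using A[OF that] by simp
      show ?thesis
        by (subst (2) lborel_distr_plus[of "a i", symmetric])
           (auto simp: emeasure_distr add.commute intro!: arg_cong[where f = "emeasure lborel"])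
    qed
    then show "emeasure (distr (\<Pi>\<^sub>M i\<in>I. lborel) (\<Pi>\<^sub>M i\<in>I. lborel) (\<lambda>y. \<lambda>i\<in>I. y i + a i)) (Pi\<^sub>E I A)
        = (\<Prod>i\<in>I. emeasure lborel (A i))"
      using A A' assms m
      by (subst emeasure_distr) (auto simp: e emeasure_PiM sets_PiM_I_finite)
  qed (use assms in simp_all)
qed

section \<open>Orthonormal coordinates and the Gaussian density\<close>

lemma orthonormal_inner:
  assumes "pairwise orthogonal C" "\<And>b. b \<in> C \<Longrightarrow> norm b = 1" "b \<in> C" "c \<in> C"
  shows "b \<bullet> c = (if b = c then 1 else 0)"
  using assms by (auto simp: pairwise_def orthogonal_def norm_eq_1)

lemma orthonormal_sum_inner:
  assumes "pairwise orthogonal C" "\<And>b. b \<in> C \<Longrightarrow> norm b = 1" "finite C" "c \<in> C"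
  shows "(\<Sum>b\<in>C. y b *\<^sub>R b) \<bullet> c = y c"
proof -
  have "(\<Sum>b\<in>C. y b *\<^sub>R b) \<bullet> c = (\<Sum>b\<in>C. if b = c then y b else 0)"
    unfolding inner_sum_left
    by (intro sum.cong refl) (use assms in \<open>auto simp: orthonormal_inner\<close>)
  then show ?thesis using assms by simp
qed

lemma orthonormal_expand:
  assumes "pairwise orthogonal C" "\<And>b. b \<in> C \<Longrightarrow> norm b = 1" "finite C" "x \<in> span C"
  shows "(\<Sum>b\<in>C. (x \<bullet> b) *\<^sub>R b) = x"
proof -
  obtain y where y: "x = (\<Sum>b\<in>C. y b *\<^sub>R b)"
    using assms(3,4) by (auto simp: span_finite)
  have "x \<bullet> b = y b" if "b \<in> C" for b
    unfolding y using that assms by (intro orthonormal_sum_inner)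
  then show ?thesis by (simp add: y)
qed

lemma norm_orthonormal_sum:
  assumes "pairwise orthogonal C" "\<And>b. b \<in> C \<Longrightarrow> norm b = 1" "finite C"
  shows "(norm (\<Sum>b\<in>C. y b *\<^sub>R b))\<^sup>2 = (\<Sum>b\<in>C. (y b)\<^sup>2)"
  using assms
  by (subst norm_sum_Pythagorean) (auto simp: pairwise_def orthogonal_clauses intro!: sum.cong)

lemma orthonormal_finite_card:
  fixes C :: "'a::euclidean_space set"
  assumes "pairwise orthogonal C" "\<And>b. b \<in> C \<Longrightarrow> norm b = 1"
  shows "finite C" and "card C = dim (span C)"
proof -
  have "independent C"
    using assms by (intro pairwise_orthogonal_independent) force+
  then show "finite C" "card C = dim (span C)"
    by (auto simp: independent_imp_finite dim_eq_card_independent)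
qed

text \<open>The standard normal density of the space. It serves twice: as the test function that
  fixes the scale of Lebesgue measure in an arbitrary orthonormal basis, and as the mollifier of
  Fourier inversion.\<close>

definition std_gauss :: "'a::euclidean_space \<Rightarrow> real" where
  "std_gauss x = exp (- (norm x)\<^sup>2 / 2) / sqrt (2 * pi) ^ DIM('a)"

lemma std_gauss_nonneg: "0 \<le> std_gauss x"
  by (simp add: std_gauss_def)

lemma borel_measurable_std_gauss[measurable]: "std_gauss \<in> borel_measurable borel"
  unfolding std_gauss_def[abs_def] by measurable

text \<open>By Pythagoras the density factorises in every orthonormal basis, not only in the
  standard one; this is where rotation invariance enters.\<close>

lemma std_gauss_orthonormal_sum:
  fixes D :: "'a::euclidean_space set"
  assumes D: "pairwise orthogonal D" "\<And>b. b \<in> D \<Longrightarrow> norm b = 1" "span D = UNIV"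
  shows "std_gauss (\<Sum>b\<in>D. y b *\<^sub>R b) = (\<Prod>b\<in>D. std_normal_density (y b))"
proof -
  note fin = orthonormal_finite_card(1)[OF D(1,2)]
  have "card D = DIM('a)"
    using orthonormal_finite_card(2)[OF D(1,2)] D(3) by simp
  moreover have "(\<Prod>b\<in>D. exp (- (y b)\<^sup>2 / 2)) = exp (- (\<Sum>b\<in>D. (y b)\<^sup>2) / 2)"
    using fin by (simp add: exp_sum[symmetric] sum_negf sum_divide_distrib)
  ultimately show ?thesis
    using norm_orthonormal_sum[OF D(1,2) fin, of y]
    by (simp add: std_gauss_def std_normal_density_def prod_dividef power_divide)
qed

lemma nn_integral_std_gauss_coordinates:
  fixes D :: "'a::euclidean_space set"
  assumes D: "pairwise orthogonal D" "\<And>b. b \<in> D \<Longrightarrow> norm b = 1" "span D = UNIV"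
  shows "(\<integral>\<^sup>+y. ennreal (std_gauss (\<Sum>b\<in>D. y b *\<^sub>R b)) \<partial>(\<Pi>\<^sub>M b\<in>D. lborel)) = 1"
proof -
  interpret product_sigma_finite "\<lambda>_. lborel :: real measure" by standard
  have "(\<integral>\<^sup>+y. ennreal (std_gauss (\<Sum>b\<in>D. y b *\<^sub>R b)) \<partial>(\<Pi>\<^sub>M b\<in>D. lborel))
      = (\<integral>\<^sup>+y. (\<Prod>b\<in>D. ennreal (std_normal_density (y b))) \<partial>(\<Pi>\<^sub>M b\<in>D. lborel))"
    by (simp add: std_gauss_orthonormal_sum[OF D] prod_ennreal)
  also have "\<dots> = (\<Prod>b\<in>D. \<integral>\<^sup>+x. ennreal (std_normal_density x) \<partial>lborel)"
    using orthonormal_finite_card(1)[OF D(1,2)] by (rule product_nn_integral_prod) measurable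
  also have "(\<integral>\<^sup>+x. ennreal (std_normal_density x) \<partial>lborel) = 1"
    using prob_space.emeasure_space_1[OF prob_space_normal_density[of 1 0]]
    by (simp add: emeasure_density)
  finally show ?thesis by simp
qed

lemma orthonormal_Basis:
  "pairwise orthogonal (Basis :: 'a::euclidean_space set)"
  by (auto simp: pairwise_def orthogonal_def inner_not_same_Basis)

lemma nn_integral_std_gauss: "(\<integral>\<^sup>+x. ennreal (std_gauss (x :: 'a::euclidean_space)) \<partial>lborel) = 1"
  using nn_integral_std_gauss_coordinates[OF orthonormal_Basis, where 'a = 'a]
  by (subst lborel_eq) (simp add: nn_integral_distr)

text \<open>No determinant is computed. The image measure is translation invariant, because shifting
  a vector shifts its coordinates, and it gives \<open>std_gauss\<close> the same mass 1 as Lebesgue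
  measure does. Uniqueness of Haar measure does the rest.\<close>

lemma distr_orthonormal_coordinates:
  fixes C :: "'a::euclidean_space set"
  assumes C: "pairwise orthogonal C" "\<And>b. b \<in> C \<Longrightarrow> norm b = 1" "span C = UNIV"
  shows "distr (\<Pi>\<^sub>M b\<in>C. lborel) borel (\<lambda>y. \<Sum>b\<in>C. y b *\<^sub>R b) = lborel"
proof -
  define S where "S y = (\<Sum>b\<in>C. y b *\<^sub>R b)" for y
  have [measurable]: "S \<in> (\<Pi>\<^sub>M b\<in>C. lborel) \<rightarrow>\<^sub>M borel"
    unfolding S_def by measurable
  have one: "(\<integral>\<^sup>+x. ennreal (std_gauss x) \<partial>distr (\<Pi>\<^sub>M b\<in>C. lborel) borel S) = 1"
    using nn_integral_std_gauss_coordinates[OF C] by (simp add: nn_integral_distr S_def)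
  note fin = orthonormal_finite_card(1)[OF C(1,2)]
  have "distr (\<Pi>\<^sub>M b\<in>C. lborel) borel (S) = lborel"
  proof (rule lborel_eqI_translation_invariant[where g = "\<lambda>x. ennreal (std_gauss x)"])
    let ?M = "distr (\<Pi>\<^sub>M b\<in>C. lborel) borel (S)"
    show "sigma_finite_measure ?M"
    proof
      have "emeasure ?M (cball 0 r) \<noteq> \<infinity>" for r
      proof -
        \<comment> \<open>The reciprocal of the least value of \<open>std_gauss\<close> on the ball
          of radius \<open>r\<close>: the indicator of the ball lies below \<open>?c\<close> times
          \<open>std_gauss\<close>, whose mass is known.\<close>
        let ?c = "sqrt (2 * pi) ^ DIM('a) * exp (r\<^sup>2 / 2)"
        have "1 \<le> ennreal ?c * ennreal (std_gauss x)" if "x \<in> cball 0 r" for x :: 'a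
        proof -
          have "(norm x)\<^sup>2 \<le> r\<^sup>2" using that by (intro power_mono) auto
          then have "exp (r\<^sup>2 / 2) * exp (- (norm x)\<^sup>2 / 2) \<ge> 1"
            by (simp flip: exp_add)
          then have "1 \<le> ?c * (exp (- (norm x)\<^sup>2 / 2) / sqrt (2 * pi) ^ DIM('a))"
            by (simp add: power_divide)
          then show ?thesis
            unfolding std_gauss_def by (subst ennreal_mult[symmetric]) auto
        qed
        then have "emeasure ?M (cball 0 r) \<le> (\<integral>\<^sup>+x. ennreal ?c * ennreal (std_gauss x) \<partial>?M)"
          by (subst nn_integral_indicator[symmetric], simp)
             (intro nn_integral_mono, auto split: split_indicator)
        also have "\<dots> = ennreal ?c"
          by (subst nn_integral_cmult) (simp_all add: one)
        finally show ?thesis using ennreal_less_top[of ?c] by (auto simp: top_unique)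
      qed
      then show "\<exists>A. countable A \<and> A \<subseteq> sets ?M \<and> \<Union>A = space ?M \<and> (\<forall>a\<in>A. emeasure ?M a \<noteq> \<infinity>)"
        by (intro exI[of _ "range (\<lambda>n::nat. cball (0::'a) (real n))"])
           (auto simp: real_arch_simple)
    qed
    show "distr ?M borel (\<lambda>x. x + a) = ?M" for a
    proof -
      have "S (\<lambda>b\<in>C. y b + a \<bullet> b) = S y + a" for y
        using orthonormal_expand[OF C(1,2) fin, of a] C(3)
        by (simp add: S_def scaleR_add_left sum.distrib)
      then have "distr ?M borel (\<lambda>x. x + a)
          = distr (\<Pi>\<^sub>M b\<in>C. lborel) borel (S \<circ> (\<lambda>y. \<lambda>b\<in>C. y b + a \<bullet> b))"
        by (simp add: distr_distr o_def)
      also have "\<dots> = distr (distr (\<Pi>\<^sub>M b\<in>C. lborel) (\<Pi>\<^sub>M b\<in>C. lborel) (\<lambda>y. \<lambda>b\<in>C. y b + a \<bullet> b)) borel (S)"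
        by (subst distr_distr) simp_all
      finally show ?thesis by (simp add: distr_PiM_lborel_shift[OF fin])
    qed
  qed (simp_all add: one nn_integral_std_gauss)
  then show ?thesis by (simp add: S_def[abs_def])
qed

text \<open>Thickening the hyperplane to a slab of width \<open>1\<close> shows that the measure does not depend on the
  chosen basis, and makes its dependence on \<open>s\<close> and \<open>u\<close> jointly measurable.\<close>

lemma nn_integral_hyperplane_measure:
  fixes s :: "real^'d::finite"
  assumes s: "norm s = 1" and [measurable]: "F \<in> borel_measurable borel"
  shows "(\<integral>\<^sup>+v. F v \<partial>hyperplane_measure s u)
    = (\<integral>\<^sup>+w. indicator {0..1} (w \<bullet> s) * F (w + (u - w \<bullet> s) *\<^sub>R s) \<partial>lborel)"
proof -
  interpret product_sigma_finite "\<lambda>_. lborel :: real measure" by standard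
  define B where "B = hyperplane_basis s"
  have hb: "pairwise orthogonal B" "\<And>b. b \<in> B \<Longrightarrow> norm b = 1" "span B = {v. v \<bullet> s = 0}"
    unfolding B_def by (fact hyperplane_basis)+
  have B0: "b \<bullet> s = 0" if "b \<in> B" for b
    using span_base[OF that] hb(3) by auto
  have ss: "s \<bullet> s = 1" using s by (simp add: norm_eq_1)
  have sB: "s \<notin> B" using B0 ss by force
  note finB = orthonormal_finite_card(1)[OF hb(1,2)]
  have on: "pairwise orthogonal (insert s B)" "\<And>b. b \<in> insert s B \<Longrightarrow> norm b = 1"
    using hb(1,2) B0 s by (auto simp: pairwise_insert orthogonal_def inner_commute)
  have "x \<in> span (insert s B)" for x
    unfolding span_breakdown_eq hb(3)
    by (rule exI[of _ "x \<bullet> s"]) (simp add: inner_diff_left ss)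
  then have sp: "span (insert s B) = UNIV" by auto
  have lb: "lborel = distr (\<Pi>\<^sub>M b\<in>insert s B. lborel) borel (\<lambda>y. \<Sum>b\<in>insert s B. y b *\<^sub>R b)"
    using distr_orthonormal_coordinates[OF on sp] by simp
  have sum_in: "(\<Sum>b\<in>B. y b *\<^sub>R b) \<bullet> s = 0" for y
    by (simp add: inner_sum_left B0)
  have upd: "(\<Sum>b\<in>B. (y(s := t)) b *\<^sub>R b) = (\<Sum>b\<in>B. y b *\<^sub>R b)" for y and t :: real
    using sB by (intro sum.cong) auto
  \<comment> \<open>In the coordinates of the basis \<open>insert s B\<close> the extra coordinate
    \<open>t\<close> equals \<open>w \<bullet> s\<close>. Projection onto the hyperplane removes it
    from the argument of \<open>F\<close>, so that only the unit thickness of the slab is left of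
    it.\<close>
  have "(\<integral>\<^sup>+w. indicator {0..1} (w \<bullet> s) * F (w + (u - w \<bullet> s) *\<^sub>R s) \<partial>lborel)
      = (\<integral>\<^sup>+y. \<integral>\<^sup>+t. indicator {0..1::real} t * F (u *\<^sub>R s + (\<Sum>b\<in>B. y b *\<^sub>R b)) \<partial>lborel \<partial>(\<Pi>\<^sub>M b\<in>B. lborel))"
  proof -
    have eq: "(\<Sum>b\<in>insert s B. (y(s := t)) b *\<^sub>R b) = t *\<^sub>R s + (\<Sum>b\<in>B. y b *\<^sub>R b)" for y and t :: real
      using finB sB upd[of y t] by simp
    show ?thesis
      by (subst lb, subst nn_integral_distr, measurable, subst product_nn_integral_insert[OF finB sB], measurable)
         (simp add: eq inner_add_left sum_in ss scaleR_diff_left add_ac del: sum.insert fun_upd_apply)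
  qed
  also have "\<dots> = (\<integral>\<^sup>+y. F (u *\<^sub>R s + (\<Sum>b\<in>B. y b *\<^sub>R b)) \<partial>(\<Pi>\<^sub>M b\<in>B. lborel))"
    by (simp add: nn_integral_multc)
  also have "\<dots> = (\<integral>\<^sup>+v. F v \<partial>hyperplane_measure s u)"
    unfolding hyperplane_measure_def B_def[symmetric] by (simp add: nn_integral_distr)
  finally show ?thesis ..
qed

text \<open>Fubini for parallel hyperplanes, in the slab form where no basis occurs. Shifting
  \<open>u\<close> by \<open>w \<bullet> s\<close> and then \<open>w\<close> by
  \<open>- u *\<^sub>R s\<close> frees \<open>f w * h (w \<bullet> s)\<close> from \<open>u\<close>;
  the indicator that remains is that of a unit interval in \<open>u\<close>.\<close>

lemma nn_integral_hyperplanes: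
  fixes s :: "real^'d::finite"
  assumes s: "norm s = 1" and [measurable]: "f \<in> borel_measurable borel" "h \<in> borel_measurable borel"
  shows "(\<integral>\<^sup>+u. (\<integral>\<^sup>+v. f v \<partial>hyperplane_measure s u) * h u \<partial>lborel) = (\<integral>\<^sup>+v. f v * h (v \<bullet> s) \<partial>lborel)"
proof -
  have ss: "s \<bullet> s = 1" using s by (simp add: norm_eq_1)
  have "(\<integral>\<^sup>+u. (\<integral>\<^sup>+v. f v \<partial>hyperplane_measure s u) * h u \<partial>lborel)
      = (\<integral>\<^sup>+u. \<integral>\<^sup>+w. indicator {0..1} (w \<bullet> s) * f (w + (u - w \<bullet> s) *\<^sub>R s) * h u \<partial>lborel \<partial>lborel)"
    by (simp add: nn_integral_hyperplane_measure[OF s] nn_integral_multc)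
  also have "\<dots> = (\<integral>\<^sup>+w. \<integral>\<^sup>+u. indicator {0..1} (w \<bullet> s) * f (w + (u - w \<bullet> s) *\<^sub>R s) * h u \<partial>lborel \<partial>lborel)"
    by (rule lborel_pair.Fubini') measurable
  also have "\<dots> = (\<integral>\<^sup>+w. \<integral>\<^sup>+u. indicator {0..1} (w \<bullet> s) * f (w + u *\<^sub>R s) * h (u + w \<bullet> s) \<partial>lborel \<partial>lborel)"
  proof (rule nn_integral_cong)
    fix w
    show "(\<integral>\<^sup>+u. indicator {0..1} (w \<bullet> s) * f (w + (u - w \<bullet> s) *\<^sub>R s) * h u \<partial>lborel)
        = (\<integral>\<^sup>+u. indicator {0..1} (w \<bullet> s) * f (w + u *\<^sub>R s) * h (u + w \<bullet> s) \<partial>lborel)"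
      by (rule trans[OF nn_integral_lborel_translate[of _ "w \<bullet> s", symmetric]]) simp_all
  qed
  also have "\<dots> = (\<integral>\<^sup>+u. \<integral>\<^sup>+w. indicator {0..1} (w \<bullet> s) * f (w + u *\<^sub>R s) * h (u + w \<bullet> s) \<partial>lborel \<partial>lborel)"
    by (rule lborel_pair.Fubini'[symmetric]) measurable
  also have "\<dots> = (\<integral>\<^sup>+u. \<integral>\<^sup>+w. indicator {0..1} (w \<bullet> s - u) * (f w * h (w \<bullet> s)) \<partial>lborel \<partial>lborel)"
  proof (rule nn_integral_cong)
    fix u
    show "(\<integral>\<^sup>+w. indicator {0..1} (w \<bullet> s) * f (w + u *\<^sub>R s) * h (u + w \<bullet> s) \<partial>lborel)
        = (\<integral>\<^sup>+w. indicator {0..1} (w \<bullet> s - u) * (f w * h (w \<bullet> s)) \<partial>lborel)"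
      by (rule trans[OF nn_integral_lborel_translate[of _ "- u *\<^sub>R s", symmetric]])
         (simp_all add: inner_diff_left ss mult.assoc)
  qed
  also have "\<dots> = (\<integral>\<^sup>+w. \<integral>\<^sup>+u. indicator {0..1} (w \<bullet> s - u) * (f w * h (w \<bullet> s)) \<partial>lborel \<partial>lborel)"
    by (rule lborel_pair.Fubini') measurable
  also have "\<dots> = (\<integral>\<^sup>+w. f w * h (w \<bullet> s) \<partial>lborel)"
    using nn_integral_lborel_reflect[of "indicator {0..1::real}"]
    by (simp add: nn_integral_multc)
  finally show ?thesis .
qed

section \<open>Polar coordinates and the law of an observation\<close>

lemma sets_sphere_measure[measurable_cong]:
  "sets (sphere_measure :: (real^'d::finite) measure) = sets (restrict_space borel (sphere 0 1))"
  by (simp add: sphere_measure_def)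

lemma space_sphere_measure: "space (sphere_measure :: (real^'d::finite) measure) = sphere 0 1"
  by (simp add: sphere_measure_def space_scale_measure space_restrict_space)

lemma finite_measure_sphere_measure: "finite_measure (sphere_measure :: (real^'d::finite) measure)"
  by (rule finite_measureI) (simp add: space_sphere_measure emeasure_sphere_measure_space)

text \<open>The sphere carries the trace of the Borel sets on a smaller space, so measurability of
  functions on the ambient space has to be transferred; the next lemma does the same for
  pairs.\<close>

lemma borel_measurable_sphere_measure:
  "F \<in> borel \<rightarrow>\<^sub>M N \<Longrightarrow> F \<in> (sphere_measure :: (real^'d::finite) measure) \<rightarrow>\<^sub>M N"
  using measurable_restrict_space1[of F borel N "sphere 0 1"] measurable_cong_sets[OF sets_sphere_measure refl]
  by blast

lemma borel_measurable_sphere_measure_pair: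
  assumes F: "F \<in> borel \<Otimes>\<^sub>M borel \<rightarrow>\<^sub>M N" and "sets M = sets borel"
  shows "F \<in> (sphere_measure :: (real^'d::finite) measure) \<Otimes>\<^sub>M M \<rightarrow>\<^sub>M N"
proof -
  have "(\<lambda>x. x) \<in> (sphere_measure :: (real^'d) measure) \<rightarrow>\<^sub>M borel"
    by (intro borel_measurable_sphere_measure) simp
  then have "(\<lambda>x. (fst x, snd x)) \<in> (sphere_measure :: (real^'d) measure) \<Otimes>\<^sub>M M \<rightarrow>\<^sub>M borel \<Otimes>\<^sub>M borel"
    using assms(2) by (intro measurable_Pair measurable_compose[OF measurable_fst])
      (simp_all cong: measurable_cong_sets)
  from measurable_compose[OF this F] show ?thesis by simp
qed

lemma nn_integral_sphere_measure:
  fixes F :: "real^'d::finite \<Rightarrow> ennreal"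
  assumes F[measurable]: "F \<in> borel_measurable borel"
  shows "(\<integral>\<^sup>+s. F s \<partial>sphere_measure)
    = of_nat CARD('d) * (\<integral>\<^sup>+x. F (x /\<^sub>R norm x) * indicator (ball 0 1 - {0}) x \<partial>lborel)"
proof -
  have [measurable]: "(\<lambda>x::real^'d. x /\<^sub>R norm x)
      \<in> restrict_space lborel (ball 0 1 - {0}) \<rightarrow>\<^sub>M restrict_space borel (sphere 0 1)"
    by (rule measurable_restrict_space2) (auto simp: space_restrict_space intro: measurable_restrict_space1)
  have [measurable]: "F \<in> borel_measurable (restrict_space borel (sphere 0 1))"
    by (intro measurable_restrict_space1) simp
  show ?thesis
    unfolding sphere_measure_def
    by (simp add: nn_integral_scale_measure nn_integral_distr nn_integral_restrict_space)
qed

text \<open>The mass of a Pareto density. In polar coordinates it is the radial integral that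
  remains at the end and absorbs the factor \<open>CARD('d)\<close> of
  \<open>sphere_measure\<close>.\<close>

lemma nn_integral_power_tail:
  fixes a :: real
  assumes "a > 0" "d > 0"
  shows "(\<integral>\<^sup>+r. ennreal (real d * a ^ d / r ^ (d + 1)) * indicator {a<..} r \<partial>lborel) = 1"
proof -
  have "(\<integral>\<^sup>+r. ennreal (real d * a ^ d / r ^ (d + 1)) * indicator {a<..} r \<partial>lborel)
      = (\<integral>\<^sup>+r. ennreal (real d * a ^ d / r ^ (d + 1)) * indicator {a..} r \<partial>lborel)"
    using AE_lborel_singleton[of a]
    by (intro nn_integral_cong_AE) (auto elim!: eventually_mono split: split_indicator)
  also have "\<dots> = ennreal (0 - (- (a ^ d / a ^ d)))"
  proof (rule nn_integral_FTC_atLeast[where F = "\<lambda>r. - (a ^ d / r ^ d)"])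
    fix r assume "a \<le> r"
    then have "r > 0" using assms by simp
    then show "((\<lambda>r. - (a ^ d / r ^ d)) has_real_derivative real d * a ^ d / r ^ (d + 1)) (at r)"
      using assms(2) power_Suc[of r "d - 1", symmetric]
      by (auto intro!: derivative_eq_intros simp: field_simps)
    show "0 \<le> real d * a ^ d / r ^ (d + 1)" using \<open>r > 0\<close> assms by simp
  next
    have "((\<lambda>r. a ^ d / r ^ d) \<longlongrightarrow> 0) at_top"
      using assms(2) by (intro tendsto_divide_0[OF tendsto_const] filterlim_at_top_imp_at_infinity
          filterlim_pow_at_top filterlim_ident)
    from tendsto_minus[OF this] show "((\<lambda>r. - (a ^ d / r ^ d)) \<longlongrightarrow> 0) at_top" by simp
  qed simp
  finally show ?thesis using assms by simp
qed

text \<open>An integral over the sphere is d times an integral over the unit ball of a function of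
  \<open>x /\<^sub>R norm x\<close>, so the right-hand side is an integral over ball and radius.
  Replacing \<open>r\<close> by \<open>norm x * r\<close> removes the normalisation, exchanging the
  integrals and replacing \<open>x\<close> by \<open>x /\<^sub>R r\<close> isolates
  \<open>h x\<close>, and the remaining integral over \<open>r > norm x\<close> is 1.\<close>

lemma nn_integral_polar:
  fixes h :: "real^'d::finite \<Rightarrow> ennreal"
  assumes h[measurable]: "h \<in> borel_measurable borel"
  shows "(\<integral>\<^sup>+t. h t \<partial>lborel)
    = (\<integral>\<^sup>+s. \<integral>\<^sup>+r. ennreal (r ^ (CARD('d) - 1)) * indicator {0<..} r * h (r *\<^sub>R s) \<partial>lborel \<partial>sphere_measure)"
proof -
  let ?d = "CARD('d)"
  define W :: "real \<Rightarrow> ennreal" where "W r = ennreal (r ^ (?d - 1)) * indicator {0<..} r" for r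
  define J :: "real^'d \<Rightarrow> ennreal" where "J = indicator (ball 0 1 - {0})"
  \<comment> \<open>What the two substitutions leave in front of \<open>h x\<close>: the factors
    r^(-d), (norm x / r)^d and r^(d-1) combine, and the unit ball becomes the ball of radius
    \<open>r\<close>.\<close>
  define T :: "real^'d \<Rightarrow> real \<Rightarrow> ennreal"
    where "T x r = (if norm x < r \<and> x \<noteq> 0 then ennreal (norm x ^ ?d / r ^ (?d + 1)) else 0)" for x r
  have [measurable]: "W \<in> borel_measurable borel" "J \<in> borel_measurable borel"
    unfolding W_def[abs_def] J_def by (simp, intro borel_measurable_indicator sets.Diff) simp_all
  have [measurable]: "(\<lambda>(x, r). T x r) \<in> borel_measurable (borel \<Otimes>\<^sub>M borel)"
    unfolding T_def by measurable
  have d: "r * r ^ (?d - 1) = r ^ ?d" for r :: real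
    using power_Suc[of r "?d - 1"] by simp
  have "(\<integral>\<^sup>+s. \<integral>\<^sup>+r. W r * h (r *\<^sub>R s) \<partial>lborel \<partial>sphere_measure)
      = of_nat ?d * (\<integral>\<^sup>+x. (\<integral>\<^sup>+r. W r * h (r *\<^sub>R (x /\<^sub>R norm x)) \<partial>lborel)
          * J x \<partial>lborel)"
    unfolding J_def by (rule nn_integral_sphere_measure) measurable
  also have "\<dots> = of_nat ?d * (\<integral>\<^sup>+x. \<integral>\<^sup>+r. ennreal (norm x ^ ?d) * J x
        * (W r * h (r *\<^sub>R x)) \<partial>lborel \<partial>lborel)"
  proof (intro arg_cong2[where f = "(*)"] refl nn_integral_cong)
    fix x :: "real^'d"
    show "(\<integral>\<^sup>+r. W r * h (r *\<^sub>R (x /\<^sub>R norm x)) \<partial>lborel) * J x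
        = (\<integral>\<^sup>+r. ennreal (norm x ^ ?d) * J x * (W r * h (r *\<^sub>R x)) \<partial>lborel)"
    proof (cases "x = 0")
      case False
      have *: "norm x * r * inverse (norm x) = r" for r
        using False by simp
      have "(\<integral>\<^sup>+r. W r * h (r *\<^sub>R (x /\<^sub>R norm x)) \<partial>lborel)
          = ennreal (norm x) * (\<integral>\<^sup>+r. W (norm x * r) * h (r *\<^sub>R x) \<partial>lborel)"
        using False by (subst nn_integral_real_affine[where c = "norm x" and t = 0]) (simp_all add: *)
      also have "(\<lambda>r. W (norm x * r) * h (r *\<^sub>R x)) = (\<lambda>r. ennreal (norm x ^ (?d - 1)) * (W r * h (r *\<^sub>R x)))"
        using False by (auto simp: W_def fun_eq_iff power_mult_distrib ennreal_mult zero_less_mult_iff mult.assoc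
            split: split_indicator)
      also have "ennreal (norm x) * (\<integral>\<^sup>+r. ennreal (norm x ^ (?d - 1)) * (W r * h (r *\<^sub>R x)) \<partial>lborel)
          = ennreal (norm x ^ ?d) * (\<integral>\<^sup>+r. W r * h (r *\<^sub>R x) \<partial>lborel)"
        by (subst nn_integral_cmult, measurable)
           (simp only: mult.assoc[symmetric] d norm_ge_zero zero_le_power flip: ennreal_mult)
      finally have *: "(\<integral>\<^sup>+r. W r * h (r *\<^sub>R (x /\<^sub>R norm x)) \<partial>lborel)
          = ennreal (norm x ^ ?d) * (\<integral>\<^sup>+r. W r * h (r *\<^sub>R x) \<partial>lborel)" .
      show ?thesis
        unfolding * by (subst nn_integral_cmult, measurable) (simp only: mult_ac)
    qed (simp add: J_def)
  qed
  also have "\<dots> = of_nat ?d * (\<integral>\<^sup>+r. \<integral>\<^sup>+x. ennreal (norm x ^ ?d) * J x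
        * (W r * h (r *\<^sub>R x)) \<partial>lborel \<partial>lborel)"
    by (subst lborel_pair.Fubini', measurable)
  also have "\<dots> = of_nat ?d * (\<integral>\<^sup>+r. \<integral>\<^sup>+x. T x r * h x \<partial>lborel \<partial>lborel)"
  proof (rule arg_cong2[where f = "(*)", OF refl], rule nn_integral_cong)
    fix r :: real
    show "(\<integral>\<^sup>+x. ennreal (norm x ^ ?d) * J x * (W r * h (r *\<^sub>R x)) \<partial>lborel)
      = (\<integral>\<^sup>+x. T x r * h x \<partial>lborel)"
    proof (cases "r > 0")
      case True
      have eq: "ennreal ((1 / r) ^ ?d) * (ennreal (norm (x /\<^sub>R r) ^ ?d) * J (x /\<^sub>R r) * (W r * h x))
          = T x r * h x" for x :: "real^'d"
      proof -
        have e: "(1 / r) ^ ?d * (norm x / r) ^ ?d * r ^ (?d - 1) = norm x ^ ?d / r ^ (?d + 1)"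
        proof -
          have "(1 / r) ^ ?d * (norm x / r) ^ ?d * r ^ (?d - 1)
              = norm x ^ ?d * r ^ (?d - 1) / (r ^ ?d * (r * r ^ (?d - 1)))"
            unfolding d power_divide by simp
          also have "\<dots> = norm x ^ ?d / (r ^ ?d * r)"
          proof -
            define q where "q = r ^ (?d - 1)"
            have "q \<noteq> 0" using True by (simp add: q_def)
            then show ?thesis unfolding q_def[symmetric] by (simp add: field_simps)
          qed
          finally show ?thesis by (simp add: mult.commute)
        qed
        have J: "J (x /\<^sub>R r) = (if norm x < r \<and> x \<noteq> 0 then 1 else 0)"
          using True by (auto simp: J_def indicator_def divide_simps)
        have n: "norm (x /\<^sub>R r) = norm x / r"
          using True by (simp add: divide_inverse)
        have "0 \<le> (1 / r) ^ ?d" "0 \<le> (norm x / r) ^ ?d" "0 \<le> r ^ (?d - 1)"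
          using True by simp_all
        then have "ennreal ((1 / r) ^ ?d) * (ennreal ((norm x / r) ^ ?d) * ennreal (r ^ (?d - 1)))
            = ennreal (norm x ^ ?d / r ^ (?d + 1))"
          unfolding e[symmetric] by (simp only: ennreal_mult[symmetric] mult_nonneg_nonneg mult.assoc)
        then show ?thesis
          unfolding T_def W_def J n using True by (cases "norm x < r \<and> x \<noteq> 0") (auto simp flip: mult.assoc)
      qed
      have "(\<integral>\<^sup>+x. ennreal (norm x ^ ?d) * J x * (W r * h (r *\<^sub>R x)) \<partial>lborel)
          = ennreal (\<bar>1 / r\<bar> ^ DIM(real^'d)) * (\<integral>\<^sup>+x. ennreal (norm (0 + (1 / r) *\<^sub>R x) ^ ?d)
            * J (0 + (1 / r) *\<^sub>R x) * (W r * h (r *\<^sub>R (0 + (1 / r) *\<^sub>R x))) \<partial>lborel)"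
        using True by (intro nn_integral_lborel_scaleR) auto
      also have "\<dots> = ennreal ((1 / r) ^ ?d) * (\<integral>\<^sup>+x. ennreal (norm (x /\<^sub>R r) ^ ?d)
            * J (x /\<^sub>R r) * (W r * h x) \<partial>lborel)"
        using True by (simp add: inverse_eq_divide[symmetric])
      also have "\<dots> = (\<integral>\<^sup>+x. T x r * h x \<partial>lborel)"
        by (subst nn_integral_cmult[symmetric], measurable) (simp only: eq)
      finally show ?thesis .
    next
      case False
      then have "\<not> norm x < r" for x :: "real^'d"
        using norm_ge_zero[of x] by linarith
      then show ?thesis using False by (simp add: W_def T_def)
    qed
  qed
  also have "\<dots> = of_nat ?d * (\<integral>\<^sup>+x. \<integral>\<^sup>+r. T x r * h x \<partial>lborel \<partial>lborel)"
    by (subst lborel_pair.Fubini', measurable)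
  also have "\<dots> = (\<integral>\<^sup>+x. (\<integral>\<^sup>+r. ennreal (real ?d * norm x ^ ?d / r ^ (?d + 1)) * indicator {norm x<..} r \<partial>lborel)
        * (indicator (- {0}) x * h x) \<partial>lborel)"
  proof -
    have "of_nat ?d * (\<integral>\<^sup>+r. T x r * h x \<partial>lborel)
        = (\<integral>\<^sup>+r. ennreal (real ?d * norm x ^ ?d / r ^ (?d + 1)) * indicator {norm x<..} r \<partial>lborel)
          * (indicator (- {0}) x * h x)" for x
    proof -
      have "of_nat ?d * T x r = ennreal (real ?d * norm x ^ ?d / r ^ (?d + 1)) * indicator {norm x<..} r * indicator (- {0}) x" for r
        by (auto simp: T_def ennreal_of_nat_eq_real_of_nat ennreal_mult'[symmetric] split: split_indicator)
      then show ?thesis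
        by (simp add: nn_integral_cmult[symmetric] nn_integral_multc[symmetric] mult.assoc[symmetric])
    qed
    then show ?thesis
      by (simp add: nn_integral_cmult[symmetric])
  qed
  also have "\<dots> = (\<integral>\<^sup>+x. h x \<partial>lborel)"
    using AE_lborel_singleton[of "0::real^'d"]
    by (intro nn_integral_cong_AE) (auto elim!: eventually_mono simp: nn_integral_power_tail[simplified])
  finally show ?thesis unfolding W_def ..
qed

definition radial_measure :: "nat \<Rightarrow> real measure" where
  "radial_measure d = density lborel (\<lambda>r. ennreal (r ^ (d - 1)) * indicator {0<..} r)"

lemma sets_radial_measure[measurable_cong, simp]: "sets (radial_measure d) = sets borel"
  by (simp add: radial_measure_def)

lemma sigma_finite_radial_measure: "sigma_finite_measure (radial_measure d)"
  unfolding radial_measure_def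
  by (subst sigma_finite_measure.sigma_finite_iff_density_finite[OF sigma_finite_lborel]) (auto simp: ennreal_mult_eq_top_iff split: split_indicator)

lemma nn_integral_radial_measure:
  "g \<in> borel_measurable borel \<Longrightarrow>
    (\<integral>\<^sup>+r. g r \<partial>radial_measure d) = (\<integral>\<^sup>+r. ennreal (r ^ (d - 1)) * indicator {0<..} r * g r \<partial>lborel)"
  unfolding radial_measure_def by (subst nn_integral_density) simp_all

text \<open>Stated as an identity of measures so that polar coordinates also apply to signed Bochner
  integrals, such as the expectation of the kernel.\<close>

lemma lborel_eq_polar:
  "lborel = distr (sphere_measure \<Otimes>\<^sub>M radial_measure CARD('d)) borel (\<lambda>(s, r). r *\<^sub>R (s :: real^'d::finite))"
proof (rule measure_eqI)
  interpret sigma_finite_measure "radial_measure CARD('d)" by (rule sigma_finite_radial_measure)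
  fix A :: "(real^'d) set" assume "A \<in> sets lborel"
  then have [measurable]: "A \<in> sets borel" by simp
  have m[measurable]: "(\<lambda>(s, r). r *\<^sub>R (s :: real^'d)) \<in> sphere_measure \<Otimes>\<^sub>M radial_measure CARD('d) \<rightarrow>\<^sub>M borel"
    by (intro borel_measurable_sphere_measure_pair) simp_all
  have "emeasure (distr (sphere_measure \<Otimes>\<^sub>M radial_measure CARD('d)) borel (\<lambda>(s, r). r *\<^sub>R s)) A
      = (\<integral>\<^sup>+p. indicator A ((\<lambda>(s, r). r *\<^sub>R s) p) \<partial>(sphere_measure \<Otimes>\<^sub>M radial_measure CARD('d)))"
    by (subst nn_integral_indicator[symmetric], simp) (subst nn_integral_distr, use m in simp_all)
  also have "\<dots> = (\<integral>\<^sup>+s. \<integral>\<^sup>+r. indicator A (r *\<^sub>R s) \<partial>radial_measure CARD('d) \<partial>sphere_measure)"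
    by (subst nn_integral_fst[symmetric]) simp_all
  also have "\<dots> = (\<integral>\<^sup>+t. indicator A t \<partial>lborel)"
    by (subst nn_integral_polar) (simp_all add: nn_integral_radial_measure)
  finally show "emeasure lborel A = emeasure (distr (sphere_measure \<Otimes>\<^sub>M radial_measure CARD('d)) borel (\<lambda>(s, r). r *\<^sub>R s)) A"
    by simp
qed simp

section \<open>The law of one observation\<close>

lemma sets_hyperplane_measure[measurable_cong, simp]: "sets (hyperplane_measure s u) = sets borel"
  by (simp add: hyperplane_measure_def)

lemma rho_pos: "d > 0 \<Longrightarrow> rho d > 0"
  by (simp add: rho_def Gamma_real_pos)

lemma sets_observation_law[measurable_cong]:
  "sets (observation_law (f :: real^'d::finite \<Rightarrow> real)) = sets (sphere_measure \<Otimes>\<^sub>M borel)"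
  by (simp add: observation_law_def cong: sets_pair_measure_cong)

lemma nn_integral_observation_law:
  fixes f :: "real^'d::finite \<Rightarrow> real" and H :: "(real^'d) \<times> real \<Rightarrow> ennreal"
  assumes f: "prob_density f" and H[measurable]: "H \<in> borel_measurable (borel \<Otimes>\<^sub>M borel)"
  shows "(\<integral>\<^sup>+p. H p \<partial>observation_law f)
    = ennreal (1 / rho CARD('d)) * (\<integral>\<^sup>+s. \<integral>\<^sup>+v. ennreal (f v) * H (s, v \<bullet> s) \<partial>lborel \<partial>sphere_measure)"
proof -
  have [measurable]: "f \<in> borel_measurable borel" and nonneg: "\<And>v. 0 \<le> f v"
    and int1: "(\<integral>\<^sup>+v. ennreal (f v) \<partial>lborel) = 1"
    using f by (auto simp: prob_density_def)
  let ?rho = "rho CARD('d)"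
  have rho: "?rho > 0" by (simp add: rho_pos)
  \<comment> \<open>The slab form of the integral of \<open>f\<close> over the hyperplane. Unlike
    the version with a chosen basis it is visibly measurable jointly in \<open>s\<close> and
    \<open>u\<close>.\<close>
  define N where "N s u = (\<integral>\<^sup>+w. indicator {0..1} (w \<bullet> s) * ennreal (f (w + (u - w \<bullet> s) *\<^sub>R s)) \<partial>lborel)"
    for s :: "real^'d" and u
  have N_meas[measurable]: "(\<lambda>(s, u). N s u) \<in> borel_measurable (borel \<Otimes>\<^sub>M borel)"
    unfolding N_def by measurable
  have N: "N s u = (\<integral>\<^sup>+v. ennreal (f v) \<partial>hyperplane_measure s u)" if "norm s = 1" for s u
    unfolding N_def using that by (simp add: nn_integral_hyperplane_measure)
  \<comment> \<open>On hyperplanes where \<open>f\<close> has infinite integral both sides are 0: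
    the Bochner integral by its default value, the other side because \<open>enn2real\<close> sends
    infinity to 0.\<close>
  have radon: "radon f s u = enn2real (N s u)" if "norm s = 1" for s u
    unfolding radon_def N[OF that] by (rule integral_eq_nn_integral) (simp_all add: nonneg)
  have dens_meas: "(\<lambda>(s, u). ennreal (enn2real (N s u) / ?rho)) \<in> borel_measurable (sphere_measure \<Otimes>\<^sub>M lborel)"
    by (rule borel_measurable_sphere_measure_pair) simp_all
  have H': "H \<in> borel_measurable (sphere_measure \<Otimes>\<^sub>M lborel)"
    by (rule borel_measurable_sphere_measure_pair) simp_all
  have "observation_law f = density (sphere_measure \<Otimes>\<^sub>M lborel) (\<lambda>(s, u). ennreal (enn2real (N s u) / ?rho))"
  proof -
    have "(\<integral>\<^sup>+p. (case p of (s, u) \<Rightarrow> ennreal (radon f s u / ?rho)) * indicator A p \<partial>(sphere_measure \<Otimes>\<^sub>M lborel))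
        = (\<integral>\<^sup>+p. (case p of (s, u) \<Rightarrow> ennreal (enn2real (N s u) / ?rho)) * indicator A p \<partial>(sphere_measure \<Otimes>\<^sub>M lborel))" for A
      by (intro nn_integral_cong) (auto simp: space_pair_measure space_sphere_measure radon)
    then show ?thesis unfolding observation_law_def density_def by simp
  qed
  then have "(\<integral>\<^sup>+p. H p \<partial>observation_law f)
      = (\<integral>\<^sup>+p. (case p of (s, u) \<Rightarrow> ennreal (enn2real (N s u) / ?rho)) * H p \<partial>(sphere_measure \<Otimes>\<^sub>M lborel))"
    using dens_meas H' by (simp add: nn_integral_density)
  also have "\<dots> = (\<integral>\<^sup>+s. \<integral>\<^sup>+u. ennreal (enn2real (N s u) / ?rho) * H (s, u) \<partial>lborel \<partial>sphere_measure)"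
    by (subst lborel.nn_integral_fst[symmetric]) (use dens_meas H' in simp_all)
  also have "\<dots> = (\<integral>\<^sup>+s. ennreal (1 / ?rho) * (\<integral>\<^sup>+v. ennreal (f v) * H (s, v \<bullet> s) \<partial>lborel) \<partial>sphere_measure)"
  proof (rule nn_integral_cong)
    fix s :: "real^'d" assume "s \<in> space sphere_measure"
    then have s: "norm s = 1" by (simp add: space_sphere_measure)
    have [measurable]: "N s \<in> borel_measurable borel"
      unfolding N_def by measurable
    have int: "(\<integral>\<^sup>+u. N s u * h u \<partial>lborel) = (\<integral>\<^sup>+v. ennreal (f v) * h (v \<bullet> s) \<partial>lborel)"
      if "h \<in> borel_measurable borel" for h
      unfolding N[OF s] using that by (intro nn_integral_hyperplanes[OF s]) simp_all
    \<comment> \<open>For each direction the hyperplane integrals have total mass 1 in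
      \<open>u\<close>, so the default value 0 occurs only on a null set and no mass is
      lost.\<close>
    have "AE u in lborel. N s u \<noteq> \<infinity>"
      using int[of "\<lambda>_. 1"] int1 by (intro nn_integral_noteq_infinite) simp_all
    then have "(\<integral>\<^sup>+u. ennreal (enn2real (N s u) / ?rho) * H (s, u) \<partial>lborel)
        = (\<integral>\<^sup>+u. ennreal (1 / ?rho) * (N s u * H (s, u)) \<partial>lborel)"
    proof (intro nn_integral_cong_AE, eventually_elim)
      fix u assume "N s u \<noteq> \<infinity>"
      then obtain a where "N s u = ennreal a" "a \<ge> 0" by (cases "N s u") auto
      then show "ennreal (enn2real (N s u) / ?rho) * H (s, u) = ennreal (1 / ?rho) * (N s u * H (s, u))"
        using rho by (simp add: mult.assoc[symmetric] flip: ennreal_mult)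
    qed
    also have "\<dots> = ennreal (1 / ?rho) * (\<integral>\<^sup>+v. ennreal (f v) * H (s, v \<bullet> s) \<partial>lborel)"
      by (simp add: nn_integral_cmult int)
    finally show "(\<integral>\<^sup>+u. ennreal (enn2real (N s u) / ?rho) * H (s, u) \<partial>lborel)
        = ennreal (1 / ?rho) * (\<integral>\<^sup>+v. ennreal (f v) * H (s, v \<bullet> s) \<partial>lborel)" .
  qed
  also have "\<dots> = ennreal (1 / ?rho) * (\<integral>\<^sup>+s. \<integral>\<^sup>+v. ennreal (f v) * H (s, v \<bullet> s) \<partial>lborel \<partial>sphere_measure)"
    by (intro nn_integral_cmult borel_measurable_sphere_measure) measurable
  finally show ?thesis .
qed

lemma prob_space_observation_law:
  fixes f :: "real^'d::finite \<Rightarrow> real"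
  assumes "prob_density f"
  shows "prob_space (observation_law f)"
proof
  have "emeasure (observation_law f) (space (observation_law f)) = (\<integral>\<^sup>+p. 1 \<partial>observation_law f)"
    by simp
  also have "\<dots> = ennreal (1 / rho CARD('d)) * ennreal (rho CARD('d))"
    using assms by (subst nn_integral_observation_law)
      (simp_all add: prob_density_def emeasure_sphere_measure_space[where 'd='d] space_sphere_measure)
  finally show "emeasure (observation_law f) (space (observation_law f)) = 1"
    using rho_pos[of "CARD('d)"] by (simp flip: ennreal_mult)
qed

section \<open>The Fourier transform on the Sobolev ellipsoid\<close>

lemma prob_densityD:
  assumes "prob_density f"
  shows "f \<in> borel_measurable borel" "\<And>y. 0 \<le> f y" "integrable lborel f"
    "prob_space (density lborel (\<lambda>y. ennreal (f y)))"
  using assms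
  by (auto simp: prob_density_def emeasure_density intro!: integrableI_nonneg prob_spaceI)

lemma fourier_eq_density:
  assumes "prob_density f"
  shows "fourier (\<lambda>y. complex_of_real (f y)) t = (CLINT y|density lborel (\<lambda>y. ennreal (f y)). iexp (t \<bullet> y))"
  unfolding fourier_def using prob_densityD(1,2)[OF assms]
  by (subst integral_density) (simp_all add: scaleR_conv_of_real mult.commute)

lemma borel_measurable_fourier[measurable]:
  assumes [measurable]: "h \<in> borel_measurable borel"
  shows "fourier h \<in> borel_measurable borel"
  unfolding fourier_def by measurable

text \<open>Along integer radii the truncated transforms converge to \<open>g\<close> in mean square
  and, dominated by \<open>f\<close>, to the Fourier integral at every point. Fatou's lemma shows
  that the two limits have distance 0.\<close>

lemma is_fourier_L2_prob_density:
  fixes f :: "real^'d::finite \<Rightarrow> real"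
  assumes f: "prob_density f" and g: "is_fourier_L2 (\<lambda>y. complex_of_real (f y)) g"
  shows "AE t in lborel. g t = fourier (\<lambda>y. complex_of_real (f y)) t"
proof -
  have [measurable]: "f \<in> borel_measurable borel" "g \<in> borel_measurable borel"
    using f g by (auto simp: prob_density_def is_fourier_L2_def L2_def)
  let ?F = "fourier (\<lambda>y. complex_of_real (f y))"
  let ?FR = "\<lambda>R. fourier (\<lambda>y. indicator (cball 0 R) y *\<^sub>R complex_of_real (f y))"
  have [measurable]: "?FR R \<in> borel_measurable borel" for R
    by (intro borel_measurable_fourier borel_measurable_scaleR borel_measurable_indicator) simp_all
  have pt: "(\<lambda>k. ?FR (real k) t) \<longlonglongrightarrow> ?F t" for t
    unfolding fourier_def
  proof (rule integral_dominated_convergence[where w = f])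
    show "AE y in lborel. (\<lambda>k. exp (\<i> * complex_of_real (t \<bullet> y)) * (indicator (cball 0 (real k)) y *\<^sub>R complex_of_real (f y)))
        \<longlonglongrightarrow> exp (\<i> * complex_of_real (t \<bullet> y)) * complex_of_real (f y)"
    proof (rule AE_I2)
      fix y :: "real^'d"
      obtain n :: nat where "norm y \<le> real n" using real_arch_simple by blast
      then show "(\<lambda>k. exp (\<i> * complex_of_real (t \<bullet> y)) * (indicator (cball 0 (real k)) y *\<^sub>R complex_of_real (f y)))
        \<longlonglongrightarrow> exp (\<i> * complex_of_real (t \<bullet> y)) * complex_of_real (f y)"
        by (intro tendsto_eventually eventually_sequentiallyI[of n]) auto
    qed
    have "0 \<le> f y" for y by (rule prob_densityD(2)[OF f])
    then show "AE y in lborel. norm (exp (\<i> * complex_of_real (t \<bullet> y)) * (indicator (cball 0 (real k)) y *\<^sub>R complex_of_real (f y))) \<le> f y" for k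
      by (auto simp: norm_mult split: split_indicator)
    show "(\<lambda>y. exp (\<i> * complex_of_real (t \<bullet> y)) * (indicator (cball 0 (real k)) y *\<^sub>R complex_of_real (f y)))
        \<in> borel_measurable lborel" for k
      by (intro borel_measurable_times borel_measurable_scaleR borel_measurable_indicator) simp_all
  qed (use prob_densityD(3)[OF f] in simp_all)
  have "(\<integral>\<^sup>+t. ennreal ((cmod (?F t - g t))\<^sup>2) \<partial>lborel)
      = (\<integral>\<^sup>+t. liminf (\<lambda>k. ennreal ((cmod (?FR (real k) t - g t))\<^sup>2)) \<partial>lborel)"
    by (intro nn_integral_cong lim_imp_Liminf[symmetric] tendsto_ennrealI tendsto_intros pt) simp_all
  also have "\<dots> \<le> liminf (\<lambda>k. \<integral>\<^sup>+t. ennreal ((cmod (?FR (real k) t - g t))\<^sup>2) \<partial>lborel)"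
    by (rule nn_integral_liminf) measurable
  also have "\<dots> = 0"
    using g unfolding is_fourier_L2_def
    by (intro lim_imp_Liminf) (auto intro: filterlim_compose[OF _ filterlim_real_sequentially])
  finally have "(\<integral>\<^sup>+t. ennreal ((cmod (?F t - g t))\<^sup>2) \<partial>lborel) = 0" by simp
  then have "AE t in lborel. ennreal ((cmod (?F t - g t))\<^sup>2) = 0"
    by (subst (asm) nn_integral_0_iff_AE) simp_all
  then show ?thesis by eventually_elim simp
qed

lemma sobolev_ellipsoid_prob_density:
  fixes f :: "real^'d::finite \<Rightarrow> real"
  assumes f: "prob_density f" and "(\<lambda>y. complex_of_real (f y)) \<in> sobolev_ellipsoid \<beta> L"
  shows "(\<integral>\<^sup>+t. ennreal ((1 + (norm t)\<^sup>2) powr \<beta> * (cmod (fourier (\<lambda>y. complex_of_real (f y)) t))\<^sup>2) \<partial>lborel) \<le> ennreal L"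
proof -
  obtain g where g: "is_fourier_L2 (\<lambda>y. complex_of_real (f y)) g"
    and L: "(\<integral>\<^sup>+t. ennreal ((1 + (norm t)\<^sup>2) powr \<beta> * (cmod (g t))\<^sup>2) \<partial>lborel) \<le> ennreal L"
    using assms(2) by (auto simp: sobolev_ellipsoid_def)
  show ?thesis
    using is_fourier_L2_prob_density[OF f g] L
    by (subst nn_integral_cong_AE[where v = "\<lambda>t. ennreal ((1 + (norm t)\<^sup>2) powr \<beta> * (cmod (g t))\<^sup>2)"])
       (auto elim!: eventually_mono)
qed

section \<open>Cauchy-Schwarz against the Sobolev weight\<close>

lemma nn_integral_weighted_Cauchy_Schwarz:
  fixes u w :: "'a \<Rightarrow> real"
  assumes [measurable]: "u \<in> borel_measurable M" "w \<in> borel_measurable M" "A \<in> sets M"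
    and w: "\<And>x. 0 < w x"
    and L: "(\<integral>\<^sup>+x. ennreal (w x * (u x)\<^sup>2) \<partial>M) \<le> ennreal L" "L > 0"
    and J: "(\<integral>\<^sup>+x. ennreal (1 / w x) * indicator A x \<partial>M) \<le> ennreal J" "J > 0"
  shows "(\<integral>\<^sup>+x. ennreal (u x) * indicator A x \<partial>M) \<le> ennreal (sqrt (L * J))"
proof -
  \<comment> \<open>Cauchy-Schwarz is obtained from a pointwise arithmetic-geometric inequality with
    a free scale \<open>l\<close>. This choice minimises \<open>l / 2 * L + 1 / (2 * l) * J\<close>,
    and the minimum is \<open>sqrt (L * J)\<close>.\<close>
  define l where "l = sqrt (J / L)"
  have l: "l > 0" using L J by (simp add: l_def)
  have pt: "u x \<le> (l / 2) * (w x * (u x)\<^sup>2) + (1 / (2 * l)) * (1 / w x)" for x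
  proof -
    have "2 * (l * w x) * u x \<le> (l * w x)\<^sup>2 * (u x)\<^sup>2 + 1"
      using zero_le_power2[of "l * w x * u x - 1"] by (simp add: power2_eq_square algebra_simps)
    then show ?thesis
      using l w[of x] by (simp add: field_simps power2_eq_square)
  qed
  have nn: "0 \<le> w x * (u x)\<^sup>2" for x using w[of x] by simp
  have "(\<integral>\<^sup>+x. ennreal (u x) * indicator A x \<partial>M)
      \<le> (\<integral>\<^sup>+x. ennreal (l / 2) * ennreal (w x * (u x)\<^sup>2) + ennreal (1 / (2 * l)) * (ennreal (1 / w x) * indicator A x) \<partial>M)"
  proof (rule nn_integral_mono)
    fix x
    have "ennreal (u x) \<le> ennreal (l / 2) * ennreal (w x * (u x)\<^sup>2) + ennreal (1 / (2 * l)) * ennreal (1 / w x)"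
      using ennreal_leI[OF pt[of x]] l w[of x] nn[of x]
      by (simp flip: ennreal_mult ennreal_plus)
    then show "ennreal (u x) * indicator A x \<le> ennreal (l / 2) * ennreal (w x * (u x)\<^sup>2)
        + ennreal (1 / (2 * l)) * (ennreal (1 / w x) * indicator A x)"
      by (simp split: split_indicator)
  qed
  also have "\<dots> = ennreal (l / 2) * (\<integral>\<^sup>+x. ennreal (w x * (u x)\<^sup>2) \<partial>M)
      + ennreal (1 / (2 * l)) * (\<integral>\<^sup>+x. ennreal (1 / w x) * indicator A x \<partial>M)"
    by (subst nn_integral_add, measurable) (simp add: nn_integral_cmult)
  also have "\<dots> \<le> ennreal (l / 2) * ennreal L + ennreal (1 / (2 * l)) * ennreal J"
    using L J by (intro add_mono mult_left_mono) auto
  also have "\<dots> = ennreal (l / 2 * L + 1 / (2 * l) * J)"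
    using l L J by (simp flip: ennreal_mult ennreal_plus)
  also have "l / 2 * L + 1 / (2 * l) * J = sqrt (L * J)"
  proof -
    have "l * L = sqrt (L * J)" "J / l = sqrt (L * J)"
      using L J by (simp_all add: l_def real_sqrt_divide real_sqrt_mult field_simps)
    then show ?thesis by (simp add: field_simps)
  qed
  finally show ?thesis .
qed

lemma nn_integral_powr_tail:
  fixes a p :: real
  assumes "a > 0" "p > 0"
  shows "(\<integral>\<^sup>+r. ennreal (r powr (- p - 1)) * indicator {a..} r \<partial>lborel) = ennreal (a powr (- p) / p)"
proof -
  have "(\<integral>\<^sup>+r. ennreal (r powr (- p - 1)) * indicator {a..} r \<partial>lborel) = ennreal (0 - (- (a powr (- p) / p)))"
  proof (rule nn_integral_FTC_atLeast[where F = "\<lambda>r. - (r powr (- p) / p)"])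
    fix r assume "a \<le> r"
    then show "((\<lambda>r. - (r powr (- p) / p)) has_real_derivative r powr (- p - 1)) (at r)"
      using assms by (auto intro!: derivative_eq_intros)
  next
    have "((\<lambda>r. r powr (- p)) \<longlongrightarrow> 0) at_top"
      using assms by (intro tendsto_neg_powr filterlim_ident) auto
    then show "((\<lambda>r. - (r powr (- p) / p)) \<longlongrightarrow> 0) at_top"
      using tendsto_minus[OF tendsto_divide[OF _ tendsto_const[of p]], of _ 0] assms by simp
  qed simp_all
  then show ?thesis by simp
qed

text \<open>Dropping the 1 from the weight leaves the radial power d - 1 - 2 \<beta> = - p - 1 in
  polar coordinates. It is integrable at infinity because p = 2 \<beta> - d is positive, and the
  cutoff at m > 0 keeps away from the origin.\<close>

lemma nn_integral_bessel_tail: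
  assumes \<beta>: "\<beta> > real CARD('d::finite) / 2" and m: "m > 0"
  shows "(\<integral>\<^sup>+t. ennreal (1 / (1 + (norm t)\<^sup>2) powr \<beta>) * indicator {t::real^'d. m < norm t} t \<partial>lborel)
    \<le> ennreal (rho CARD('d) * (m powr (real CARD('d) - 2 * \<beta>) / (2 * \<beta> - real CARD('d))))"
proof -
  let ?d = "CARD('d)"
  define p where "p = 2 * \<beta> - real ?d"
  have p: "p > 0" using \<beta> by (simp add: p_def)
  have pw: "r ^ (?d - 1) * (1 / (1 + r\<^sup>2) powr \<beta>) \<le> r powr (- p - 1)" if "r > 0" for r
  proof -
    have "r powr (2 * \<beta>) = r\<^sup>2 powr \<beta>"
      using that by (simp add: powr_powr flip: powr_numeral)
    also have "\<dots> \<le> (1 + r\<^sup>2) powr \<beta>"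
      using \<beta> by (intro powr_mono2) (auto intro: order_trans[of 0 "real ?d / 2"])
    finally have "1 / (1 + r\<^sup>2) powr \<beta> \<le> r powr (- 2 * \<beta>)"
      using that by (simp add: powr_minus divide_inverse le_imp_inverse_le)
    then have "r ^ (?d - 1) * (1 / (1 + r\<^sup>2) powr \<beta>) \<le> r ^ (?d - 1) * r powr (- 2 * \<beta>)"
      using that by (intro mult_left_mono) simp_all
    also have "\<dots> = r powr (real ?d - 1) * r powr (- 2 * \<beta>)"
      using powr_realpow[OF that, of "?d - 1"] by (simp add: of_nat_diff Suc_leI)
    also have "\<dots> = r powr (- p - 1)"
      unfolding powr_add[symmetric] p_def by (simp add: algebra_simps)
    finally show ?thesis .
  qed
  have "(\<integral>\<^sup>+t. ennreal (1 / (1 + (norm t)\<^sup>2) powr \<beta>) * indicator {t::real^'d. m < norm t} t \<partial>lborel)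
      = (\<integral>\<^sup>+s. \<integral>\<^sup>+r. ennreal (r ^ (?d - 1)) * indicator {0<..} r
          * (ennreal (1 / (1 + (norm (r *\<^sub>R (s :: real^'d)))\<^sup>2) powr \<beta>) * indicator {t::real^'d. m < norm t} (r *\<^sub>R s)) \<partial>lborel \<partial>sphere_measure)"
    by (rule nn_integral_polar) simp
  also have "\<dots> \<le> (\<integral>\<^sup>+s. \<integral>\<^sup>+r. ennreal (r powr (- p - 1)) * indicator {m..} r \<partial>lborel \<partial>(sphere_measure :: (real^'d) measure))"
  proof (intro nn_integral_mono)
    fix s :: "real^'d" and r :: real assume "s \<in> space sphere_measure"
    then have "norm s = 1" by (simp add: space_sphere_measure)
    then show "ennreal (r ^ (?d - 1)) * indicator {0<..} r
          * (ennreal (1 / (1 + (norm (r *\<^sub>R s))\<^sup>2) powr \<beta>) * indicator {t::real^'d. m < norm t} (r *\<^sub>R s))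
        \<le> ennreal (r powr (- p - 1)) * indicator {m..} r"
      using m pw[of r] by (auto split: split_indicator simp flip: ennreal_mult intro!: ennreal_leI)
  qed
  also have "\<dots> = ennreal (m powr (- p) / p) * ennreal (rho ?d)"
    by (simp add: nn_integral_powr_tail[OF m p] space_sphere_measure emeasure_sphere_measure_space)
  finally show ?thesis
    using p rho_pos[of ?d] by (simp add: p_def mult.commute flip: ennreal_mult)
qed

lemma nn_integral_bessel_finite:
  assumes \<beta>: "\<beta> > real CARD('d::finite) / 2"
  obtains J where "J > 0" "(\<integral>\<^sup>+t. ennreal (1 / (1 + (norm (t::real^'d))\<^sup>2) powr \<beta>) \<partial>lborel) \<le> ennreal J"
proof -
  let ?w = "\<lambda>t::real^'d. ennreal (1 / (1 + (norm t)\<^sup>2) powr \<beta>)"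
  have b0: "\<beta> \<ge> 0" using \<beta> by (auto intro: order_trans[of 0 "real CARD('d) / 2"])
  have "(\<integral>\<^sup>+t. ?w t \<partial>lborel) \<le> (\<integral>\<^sup>+t. indicator (cball 0 1) t + ?w t * indicator {t. 1 < norm t} t \<partial>lborel)"
  proof (rule nn_integral_mono)
    fix t :: "real^'d"
    have "1 / (1 + (norm t)\<^sup>2) powr \<beta> \<le> 1"
      using b0 ge_one_powr_ge_zero[of "1 + (norm t)\<^sup>2" \<beta>]
      by (subst divide_le_eq_1) auto
    then show "?w t \<le> indicator (cball 0 1) t + ?w t * indicator {t. 1 < norm t} t"
      using ennreal_leI[of _ 1] by (auto split: split_indicator)
  qed
  also have "\<dots> = emeasure lborel (cball 0 1 :: (real^'d) set) + (\<integral>\<^sup>+t. ?w t * indicator {t. 1 < norm t} t \<partial>lborel)"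
    by (subst nn_integral_add) (simp_all add: borel_measurable_indicator)
  also have "\<dots> < \<infinity>"
    using emeasure_lborel_cball_finite nn_integral_bessel_tail[OF \<beta>, of 1]
    by (auto simp: less_top[symmetric] top_unique)
  finally obtain J0 where "J0 \<ge> 0" "(\<integral>\<^sup>+t. ?w t \<partial>lborel) = ennreal J0"
    by (cases "\<integral>\<^sup>+t. ?w t \<partial>lborel") auto
  \<comment> \<open>Adding 1 makes the bound strictly positive, as the scale \<open>l\<close> in the
    Cauchy-Schwarz lemma demands.\<close>
  then show ?thesis
    by (intro that[of "J0 + 1"]) (auto intro!: ennreal_leI)
qed

section \<open>Fourier inversion\<close>

lemma lborel_integral_scaleR:
  fixes f :: "'a::euclidean_space \<Rightarrow> 'b::{banach, second_countable_topology}"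
  assumes [measurable]: "f \<in> borel_measurable borel" and "c \<noteq> 0"
  shows "(LINT x|lborel. f x) = (\<bar>c\<bar> ^ DIM('a)) *\<^sub>R (LINT x|lborel. f (c *\<^sub>R x))"
  by (subst lborel_affine[OF \<open>c \<noteq> 0\<close>, of 0])
     (simp add: integral_density integral_distr)

lemma fourier_gauss_real:
  "(CLINT t|lborel. iexp (t * a) * complex_of_real (exp (- t\<^sup>2 / 2))) = complex_of_real (2 * pi * std_normal_density a)"
proof -
  have "(CLINT x|lborel. std_normal_density x *\<^sub>R iexp (a * x)) = char std_normal_distribution a"
    unfolding char_def by (subst integral_density) simp_all
  then have e: "(CLINT x|lborel. std_normal_density x *\<^sub>R iexp (a * x)) = complex_of_real (exp (- a\<^sup>2 / 2))"
    by (simp add: char_std_normal_distribution)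
  have "(CLINT t|lborel. iexp (t * a) * complex_of_real (exp (- t\<^sup>2 / 2)))
      = (CLINT x|lborel. complex_of_real (sqrt (2 * pi)) * (std_normal_density x *\<^sub>R iexp (a * x)))"
    by (intro Bochner_Integration.integral_cong refl)
       (simp add: std_normal_density_def scaleR_conv_of_real mult_ac)
  also have "\<dots> = complex_of_real (sqrt (2 * pi) * exp (- a\<^sup>2 / 2))"
    unfolding integral_mult_right_zero e by simp
  also have "sqrt (2 * pi) * exp (- a\<^sup>2 / 2) = 2 * pi * std_normal_density a"
    by (simp add: std_normal_density_def field_simps)
  finally show ?thesis .
qed

text \<open>The integrand is a product over the coordinates, and each factor is the characteristic
  function of the standard normal law up to the constant \<open>sqrt (2 * pi)\<close>.\<close>

lemma fourier_gauss:
  fixes x :: "'a::euclidean_space"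
  shows "(CLINT t|lborel. iexp (t \<bullet> x) * complex_of_real (exp (- (norm t)\<^sup>2 / 2)))
    = complex_of_real ((2 * pi) ^ DIM('a) * std_gauss x)"
proof -
  interpret product_sigma_finite "\<lambda>_. lborel :: real measure" by standard
  have eq: "iexp ((\<Sum>b\<in>Basis. y b *\<^sub>R b) \<bullet> x) * complex_of_real (exp (- (norm (\<Sum>b\<in>Basis. y b *\<^sub>R b))\<^sup>2 / 2))
      = (\<Prod>b\<in>(Basis :: 'a set). iexp (y b * (x \<bullet> b)) * complex_of_real (exp (- (y b)\<^sup>2 / 2)))" for y
  proof -
    have "(norm (\<Sum>b\<in>Basis. y b *\<^sub>R b))\<^sup>2 = (\<Sum>b\<in>(Basis :: 'a set). (y b)\<^sup>2)"
      by (rule norm_orthonormal_sum) (simp_all add: orthonormal_Basis)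
    moreover have "(\<Sum>b\<in>Basis. y b *\<^sub>R b) \<bullet> x = (\<Sum>b\<in>(Basis :: 'a set). y b * (x \<bullet> b))"
      by (simp add: inner_sum_left inner_commute[of x])
    ultimately show ?thesis
      by (simp add: prod.distrib exp_sum[symmetric] sum_distrib_left sum_negf sum_divide_distrib flip: of_real_prod)
  qed
  have int: "integrable lborel (\<lambda>t. iexp (t * a) * complex_of_real (exp (- t\<^sup>2 / 2)))" for a
  proof (rule Bochner_Integration.integrable_bound)
    show "integrable lborel (\<lambda>t. sqrt (2 * pi) * std_normal_density t)" by simp
  qed (auto simp: norm_mult std_normal_density_def)
  have "(CLINT t|lborel. iexp (t \<bullet> x) * complex_of_real (exp (- (norm t)\<^sup>2 / 2)))
      = (CLINT y|(\<Pi>\<^sub>M b\<in>Basis. lborel). (\<Prod>b\<in>(Basis :: 'a set). iexp (y b * (x \<bullet> b)) * complex_of_real (exp (- (y b)\<^sup>2 / 2))))"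
    by (subst lborel_eq, subst integral_distr) (simp_all only: eq, simp_all)
  also have "\<dots> = (\<Prod>b\<in>(Basis :: 'a set). CLINT t|lborel. iexp (t * (x \<bullet> b)) * complex_of_real (exp (- t\<^sup>2 / 2)))"
    by (rule product_integral_prod) (simp, rule int)
  also have "\<dots> = complex_of_real ((2 * pi) ^ DIM('a) * std_gauss x)"
  proof -
    have "std_gauss x = (\<Prod>b\<in>Basis. std_normal_density (x \<bullet> b))"
      using std_gauss_orthonormal_sum[OF orthonormal_Basis, of "\<lambda>b. x \<bullet> b"]
      by (simp add: euclidean_representation)
    then show ?thesis
      by (simp only: fourier_gauss_real prod.distrib prod_constant power_mult_distrib flip: of_real_prod)
  qed
  finally show ?thesis .
qed

lemma fourier_gauss_scaled:
  fixes w :: "'a::euclidean_space"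
  assumes "\<epsilon> > 0"
  shows "(CLINT t|lborel. iexp (t \<bullet> w) * complex_of_real (exp (- (norm (\<epsilon> *\<^sub>R t))\<^sup>2 / 2)))
    = complex_of_real ((2 * pi / \<epsilon>) ^ DIM('a) * std_gauss (w /\<^sub>R \<epsilon>))"
proof -
  have "(CLINT t|lborel. iexp (t \<bullet> w) * complex_of_real (exp (- (norm (\<epsilon> *\<^sub>R t))\<^sup>2 / 2)))
    = (\<bar>1 / \<epsilon>\<bar> ^ DIM('a)) *\<^sub>R (CLINT t|lborel. iexp (((1 / \<epsilon>) *\<^sub>R t) \<bullet> w)
      * complex_of_real (exp (- (norm (\<epsilon> *\<^sub>R ((1 / \<epsilon>) *\<^sub>R t)))\<^sup>2 / 2)))"
    using assms by (intro lborel_integral_scaleR) auto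
  also have "\<dots> = ((1 / \<epsilon>) ^ DIM('a)) *\<^sub>R (CLINT t|lborel. iexp (t \<bullet> (w /\<^sub>R \<epsilon>)) * complex_of_real (exp (- (norm t)\<^sup>2 / 2)))"
  proof -
    have "\<epsilon> *\<^sub>R ((1 / \<epsilon>) *\<^sub>R t) = t" "((1 / \<epsilon>) *\<^sub>R t) \<bullet> w = t \<bullet> (w /\<^sub>R \<epsilon>)" "\<bar>1 / \<epsilon>\<bar> = 1 / \<epsilon>" for t
      using assms by (simp_all add: inverse_eq_divide)
    then show ?thesis by (simp only:)
  qed
  also have "\<dots> = complex_of_real ((1 / \<epsilon>) ^ DIM('a) * ((2 * pi) ^ DIM('a) * std_gauss (w /\<^sub>R \<epsilon>)))"
    unfolding fourier_gauss by (simp add: scaleR_conv_of_real)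
  finally show ?thesis
    by (simp add: power_divide)
qed

text \<open>Continuous functions that differ at a point differ on a ball, which has positive volume.
  This gives the uniqueness that the description in \<open>continuous_version\<close>
  requires.\<close>

lemma continuous_AE_eq:
  fixes g h :: "'a::euclidean_space \<Rightarrow> 'b::t2_space"
  assumes "continuous_on UNIV g" "continuous_on UNIV h" "AE x in lborel. g x = h x"
  shows "g = h"
proof (rule ccontr)
  assume "g \<noteq> h"
  then obtain x where x: "g x \<noteq> h x" by auto
  have "open {x. g x \<noteq> h x}"
    using assms(1,2) by (intro open_Collect_neq) auto
  then obtain e where e: "e > 0" "ball x e \<subseteq> {x. g x \<noteq> h x}"
    using x by (auto simp: open_contains_ball)
  have "AE y in lborel. y \<notin> ball x e"
    using assms(3) e(2) by (auto elim!: eventually_mono)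
  then have "ball x e \<in> null_sets lborel"
    by (subst AE_iff_null_sets) auto
  then show False
    using e(1) unit_ball_vol_pos[of "real DIM('a)"] by (auto simp: null_sets_def emeasure_ball)
qed

section \<open>Gaussian regularisation of a probability measure\<close>

locale euclidean_prob = prob_space M for M :: "'a::euclidean_space measure" +
  assumes sets_M[measurable_cong]: "sets M = sets borel"
begin

definition phi :: "'a \<Rightarrow> complex" where
  "phi t = (CLINT y|M. iexp (t \<bullet> y))"

definition inv_phi :: "'a \<Rightarrow> real" where
  "inv_phi x = Re (CLINT t|lborel. iexp (- (t \<bullet> x)) * phi t) / (2 * pi) ^ DIM('a)"

text \<open>The density at \<open>x\<close> of Y + \<epsilon> Z, where Y has law \<open>M\<close>
  and Z is standard normal and independent of Y.\<close>

definition smoothed :: "real \<Rightarrow> 'a \<Rightarrow> real" where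
  "smoothed \<epsilon> x = (LINT y|M. std_gauss ((y - x) /\<^sub>R \<epsilon>) / \<epsilon> ^ DIM('a))"

lemma phi_measurable[measurable]: "phi \<in> borel_measurable borel"
  unfolding phi_def[abs_def] by measurable

lemma norm_phi_le: "cmod (phi t) \<le> 1"
  unfolding phi_def by (rule order_trans[OF integral_norm_bound]) (simp add: prob_space)

text \<open>Inversion with a Gaussian damping factor: the factor makes the double integral
  absolutely convergent for every \<open>M\<close>, so Fubini applies before anything is known about
  the integrability of \<open>phi\<close>, and the inner integral is the transform of a
  Gaussian.\<close>

lemma smoothed_eq:
  assumes "\<epsilon> > 0"
  shows "(CLINT t|lborel. iexp (- (t \<bullet> x)) * complex_of_real (exp (- (norm (\<epsilon> *\<^sub>R t))\<^sup>2 / 2)) * phi t)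
    = complex_of_real ((2 * pi) ^ DIM('a) * smoothed \<epsilon> x)"
proof -
  interpret pair_sigma_finite M lborel by unfold_locales
  let ?K = "\<lambda>t. exp (- (norm (\<epsilon> *\<^sub>R t))\<^sup>2 / 2)"
  have K: "?K t = sqrt (2 * pi) ^ DIM('a) * std_gauss (\<epsilon> *\<^sub>R t)" for t :: 'a
    by (simp add: std_gauss_def)
  have "(\<integral>\<^sup>+t. ennreal (std_gauss (t::'a)) \<partial>lborel) = ennreal (\<epsilon> ^ DIM('a)) * (\<integral>\<^sup>+t. ennreal (std_gauss (\<epsilon> *\<^sub>R (t::'a))) \<partial>lborel)"
    using nn_integral_lborel_scaleR[of "\<lambda>t::'a. ennreal (std_gauss t)" \<epsilon> 0] assms by simp
  then have "(\<integral>\<^sup>+t. ennreal (std_gauss (\<epsilon> *\<^sub>R (t::'a))) \<partial>lborel) \<noteq> \<infinity>"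
    using assms by (auto simp: nn_integral_std_gauss ennreal_mult_top)
  then have fin: "(\<integral>\<^sup>+t. ennreal (?K (t::'a)) \<partial>lborel) < \<infinity>"
    unfolding K by (simp add: ennreal_mult std_gauss_nonneg nn_integral_cmult less_top ennreal_mult_less_top)
  have "(CLINT t|lborel. iexp (- (t \<bullet> x)) * complex_of_real (?K t) * phi t)
      = (CLINT t|lborel. CLINT y|M. iexp (t \<bullet> (y - x)) * complex_of_real (?K t))"
  proof -
    have "iexp (t \<bullet> (y - x)) = iexp (- (t \<bullet> x)) * iexp (t \<bullet> y)" for t y
      by (simp add: inner_diff_right right_diff_distrib flip: exp_add)
    then have "iexp (- (t \<bullet> x)) * c * iexp (t \<bullet> y) = iexp (t \<bullet> (y - x)) * c" for t y c
      by simp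
    then show ?thesis
      unfolding phi_def by (simp only: flip: integral_mult_right_zero)
  qed
  also have "\<dots> = (CLINT y|M. CLINT t|lborel. iexp (t \<bullet> (y - x)) * complex_of_real (?K t))"
  proof (rule Fubini_integral)
    show "integrable (M \<Otimes>\<^sub>M lborel) (\<lambda>(y, t). iexp (t \<bullet> (y - x)) * complex_of_real (?K t))"
      unfolding integrable_iff_bounded
    proof
      have "(\<integral>\<^sup>+p. ennreal (norm (case p of (y, t) \<Rightarrow> iexp (t \<bullet> (y - x)) * complex_of_real (?K t))) \<partial>(M \<Otimes>\<^sub>M lborel))
          = (\<integral>\<^sup>+y. \<integral>\<^sup>+t. ennreal (?K (t::'a)) \<partial>lborel \<partial>M)"
        by (subst lborel.nn_integral_fst[symmetric], measurable) (simp add: norm_mult)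
      also have "\<dots> < \<infinity>" using fin by (simp add: emeasure_space_1)
      finally show "(\<integral>\<^sup>+p. ennreal (norm (case p of (y, t) \<Rightarrow> iexp (t \<bullet> (y - x)) * complex_of_real (?K t))) \<partial>(M \<Otimes>\<^sub>M lborel)) < \<infinity>" .
    qed measurable
  qed
  also have "\<dots> = (CLINT y|M. complex_of_real ((2 * pi) ^ DIM('a) * (std_gauss ((y - x) /\<^sub>R \<epsilon>) / \<epsilon> ^ DIM('a))))"
    unfolding fourier_gauss_scaled[OF assms] by (simp add: power_divide)
  also have "\<dots> = complex_of_real ((2 * pi) ^ DIM('a) * smoothed \<epsilon> x)"
    unfolding integral_complex_of_real smoothed_def by simp
  finally show ?thesis .
qed

lemma smoothed_nonneg: "\<epsilon> > 0 \<Longrightarrow> 0 \<le> smoothed \<epsilon> x"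
  unfolding smoothed_def by (intro Bochner_Integration.integral_nonneg) (simp add: std_gauss_nonneg)

lemma borel_measurable_smoothed[measurable]: "smoothed \<epsilon> \<in> borel_measurable borel"
  unfolding smoothed_def[abs_def] by measurable

text \<open>The substitution x = y - \<epsilon> z turns the smoothed density into a noise variable
  \<open>z\<close> with a law free of \<epsilon>, in which the limit \<epsilon> to 0 can be
  taken.\<close>

lemma nn_integral_smoothed:
  assumes "\<epsilon> > 0" and [measurable]: "g \<in> borel_measurable borel"
  shows "(\<integral>\<^sup>+x. g x * ennreal (smoothed \<epsilon> x) \<partial>lborel)
    = (\<integral>\<^sup>+y. \<integral>\<^sup>+z. g (y - \<epsilon> *\<^sub>R z) * ennreal (std_gauss z) \<partial>lborel \<partial>M)"
proof -
  interpret pair_sigma_finite M lborel by unfold_locales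
  have "ennreal (smoothed \<epsilon> x) = (\<integral>\<^sup>+y. ennreal (std_gauss ((y - x) /\<^sub>R \<epsilon>) / \<epsilon> ^ DIM('a)) \<partial>M)" for x
    unfolding smoothed_def
  proof (rule nn_integral_eq_integral[symmetric])
    have "norm (std_gauss (v :: 'a) / \<epsilon> ^ DIM('a)) \<le> 1 / sqrt (2 * pi) ^ DIM('a) / \<epsilon> ^ DIM('a)" for v
      using assms(1) unfolding real_norm_def std_gauss_def
      by (subst abs_of_nonneg, simp, intro divide_right_mono) simp_all
    then show "integrable M (\<lambda>y. std_gauss ((y - x) /\<^sub>R \<epsilon>) / \<epsilon> ^ DIM('a))"
      by (intro integrable_const_bound[where B = "1 / sqrt (2 * pi) ^ DIM('a) / \<epsilon> ^ DIM('a)"] AE_I2) simp_all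
  qed (use assms(1) in \<open>simp add: std_gauss_nonneg\<close>)
  then have "(\<integral>\<^sup>+x. g x * ennreal (smoothed \<epsilon> x) \<partial>lborel)
      = (\<integral>\<^sup>+x. \<integral>\<^sup>+y. g x * ennreal (std_gauss ((y - x) /\<^sub>R \<epsilon>) / \<epsilon> ^ DIM('a)) \<partial>M \<partial>lborel)"
    by (simp add: nn_integral_cmult)
  also have "\<dots> = (\<integral>\<^sup>+y. \<integral>\<^sup>+x. g x * ennreal (std_gauss ((y - x) /\<^sub>R \<epsilon>) / \<epsilon> ^ DIM('a)) \<partial>lborel \<partial>M)"
    by (rule Fubini') measurable
  also have "\<dots> = (\<integral>\<^sup>+y. \<integral>\<^sup>+z. g (y - \<epsilon> *\<^sub>R z) * ennreal (std_gauss z) \<partial>lborel \<partial>M)"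
  proof (rule nn_integral_cong)
    fix y
    have "(\<integral>\<^sup>+x. g x * ennreal (std_gauss ((y - x) /\<^sub>R \<epsilon>) / \<epsilon> ^ DIM('a)) \<partial>lborel)
        = ennreal (\<epsilon> ^ DIM('a)) * (\<integral>\<^sup>+z. g (y - \<epsilon> *\<^sub>R z) * ennreal (std_gauss z / \<epsilon> ^ DIM('a)) \<partial>lborel)"
      using assms by (subst nn_integral_lborel_scaleR[where c = "- \<epsilon>" and t = y]) simp_all
    also have "\<dots> = (\<integral>\<^sup>+z. ennreal (\<epsilon> ^ DIM('a)) * (g (y - \<epsilon> *\<^sub>R z) * ennreal (std_gauss z / \<epsilon> ^ DIM('a))) \<partial>lborel)"
      by (rule nn_integral_cmult[symmetric]) measurable
    also have "\<dots> = (\<integral>\<^sup>+z. g (y - \<epsilon> *\<^sub>R z) * ennreal (std_gauss z) \<partial>lborel)"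
    proof (rule nn_integral_cong)
      fix z :: 'a
      have "ennreal (\<epsilon> ^ DIM('a)) * ennreal (std_gauss z / \<epsilon> ^ DIM('a)) = ennreal (std_gauss z)"
        using assms(1) std_gauss_nonneg[of z] by (subst ennreal_mult[symmetric]) simp_all
      then show "ennreal (\<epsilon> ^ DIM('a)) * (g (y - \<epsilon> *\<^sub>R z) * ennreal (std_gauss z / \<epsilon> ^ DIM('a)))
          = g (y - \<epsilon> *\<^sub>R z) * ennreal (std_gauss z)"
        by (metis mult.left_commute)
    qed
    finally show "(\<integral>\<^sup>+x. g x * ennreal (std_gauss ((y - x) /\<^sub>R \<epsilon>) / \<epsilon> ^ DIM('a)) \<partial>lborel)
        = (\<integral>\<^sup>+z. g (y - \<epsilon> *\<^sub>R z) * ennreal (std_gauss z) \<partial>lborel)" .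
  qed
  finally show ?thesis .
qed

text \<open>Vanishing noise gives weak convergence to \<open>M\<close>. Dominated convergence is
  used twice, for \<open>z\<close> and then for \<open>y\<close>; the bound 1 on \<open>g\<close>
  supplies both majorants.\<close>

lemma nn_integral_smoothed_tendsto:
  fixes g :: "'a \<Rightarrow> real"
  assumes g: "continuous_on UNIV g" "\<And>x. 0 \<le> g x" "\<And>x. g x \<le> 1"
  shows "(\<lambda>k. \<integral>\<^sup>+x. ennreal (g x) * ennreal (smoothed (1 / real (Suc k)) x) \<partial>lborel)
    \<longlonglongrightarrow> (\<integral>\<^sup>+y. ennreal (g y) \<partial>M)"
proof -
  have [measurable]: "g \<in> borel_measurable borel"
    using g(1) by (rule borel_measurable_continuous_onI)
  let ?I = "\<lambda>k y. \<integral>\<^sup>+z. ennreal (g (y - (1 / real (Suc k)) *\<^sub>R z)) * ennreal (std_gauss z) \<partial>lborel"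
  have g1: "ennreal (g x) \<le> 1" for x
    using ennreal_leI[OF g(3), of x] by simp
  have le: "?I k y \<le> 1" for k y
    using nn_integral_mono[of lborel "\<lambda>z. ennreal (g (y - (1 / real (Suc k)) *\<^sub>R z)) * ennreal (std_gauss z)" "\<lambda>z. ennreal (std_gauss z)"]
      mult_right_mono[OF g1, of _] by (simp add: nn_integral_std_gauss)
  have lim: "(\<lambda>k. ?I k y) \<longlonglongrightarrow> ennreal (g y)" for y
  proof -
    have "(\<lambda>k. ?I k y) \<longlonglongrightarrow> (\<integral>\<^sup>+z. ennreal (g y) * ennreal (std_gauss z) \<partial>(lborel :: 'a measure))"
    proof (rule nn_integral_dominated_convergence[where w = "\<lambda>z. ennreal (std_gauss z)"])
      show "AE z in lborel. ennreal (g (y - (1 / real (Suc k)) *\<^sub>R z)) * ennreal (std_gauss z) \<le> ennreal (std_gauss z)" for k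
        using mult_right_mono[OF g1] by (intro AE_I2) fastforce
      show "AE z in lborel. (\<lambda>k. ennreal (g (y - (1 / real (Suc k)) *\<^sub>R z)) * ennreal (std_gauss z))
          \<longlonglongrightarrow> ennreal (g y) * ennreal (std_gauss z)"
      proof (rule AE_I2)
        fix z :: 'a
        have "(\<lambda>k. y - (1 / real (Suc k)) *\<^sub>R z) \<longlonglongrightarrow> y - 0 *\<^sub>R z"
          by (intro tendsto_intros LIMSEQ_Suc[OF lim_1_over_n])
        then have "(\<lambda>k. g (y - (1 / real (Suc k)) *\<^sub>R z)) \<longlonglongrightarrow> g y"
          using g(1) by (intro continuous_on_tendsto_compose[of UNIV g]) simp_all
        then show "(\<lambda>k. ennreal (g (y - (1 / real (Suc k)) *\<^sub>R z)) * ennreal (std_gauss z))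
          \<longlonglongrightarrow> ennreal (g y) * ennreal (std_gauss z)"
          by (intro tendsto_mult_ennreal tendsto_ennrealI tendsto_const) simp_all
      qed
    qed (simp_all add: nn_integral_std_gauss)
    then show ?thesis by (simp add: nn_integral_cmult nn_integral_std_gauss)
  qed
  have "(\<lambda>k. \<integral>\<^sup>+y. ?I k y \<partial>M) \<longlonglongrightarrow> (\<integral>\<^sup>+y. ennreal (g y) \<partial>M)"
    by (rule nn_integral_dominated_convergence[where w = "\<lambda>_. 1"]) (use le lim in \<open>simp_all add: emeasure_space_1\<close>)
  then show ?thesis by (simp add: nn_integral_smoothed del: of_nat_Suc)
qed

section \<open>Inversion for an integrable characteristic function\<close>

context
  assumes phi_int: "integrable lborel phi"
begin

lemma integrable_inv_phi: "integrable lborel (\<lambda>t. iexp (- (t \<bullet> x)) * phi t)"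
  using phi_int by (rule Bochner_Integration.integrable_bound) (auto simp: norm_mult)

lemma continuous_inv_phi: "continuous_on UNIV inv_phi"
proof -
  have "(\<lambda>k. CLINT t|lborel. iexp (- (t \<bullet> X k)) * phi t) \<longlonglongrightarrow> (CLINT t|lborel. iexp (- (t \<bullet> x)) * phi t)"
    if "X \<longlonglongrightarrow> x" for X x
  proof (rule integral_dominated_convergence[where w = "\<lambda>t. cmod (phi t)"])
    show "AE t in lborel. (\<lambda>k. iexp (- (t \<bullet> X k)) * phi t) \<longlonglongrightarrow> iexp (- (t \<bullet> x)) * phi t"
      using that by (intro AE_I2 tendsto_intros)
  qed (use phi_int in \<open>auto simp: norm_mult\<close>)
  then have "continuous_on UNIV (\<lambda>x. CLINT t|lborel. iexp (- (t \<bullet> x)) * phi t)"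
    by (intro continuous_on_sequentiallyI) (auto simp: o_def)
  then show ?thesis
    unfolding inv_phi_def[abs_def] by (intro continuous_intros) auto
qed

lemma borel_measurable_inv_phi[measurable]: "inv_phi \<in> borel_measurable borel"
  by (rule borel_measurable_continuous_onI[OF continuous_inv_phi])

lemma smoothed_eq_Re:
  assumes "\<epsilon> > 0"
  shows "smoothed \<epsilon> x = Re (CLINT t|lborel. iexp (- (t \<bullet> x)) * complex_of_real (exp (- (norm (\<epsilon> *\<^sub>R t))\<^sup>2 / 2)) * phi t)
      / (2 * pi) ^ DIM('a)"
  unfolding smoothed_eq[OF assms] by simp

lemma smoothed_tendsto: "(\<lambda>k. smoothed (1 / real (Suc k)) x) \<longlonglongrightarrow> inv_phi x"
proof -
  let ?F = "\<lambda>k. CLINT t|lborel. iexp (- (t \<bullet> x)) * complex_of_real (exp (- (norm ((1 / real (Suc k)) *\<^sub>R t))\<^sup>2 / 2)) * phi t"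
  have "?F \<longlonglongrightarrow> (CLINT t|lborel. iexp (- (t \<bullet> x)) * phi t)"
  proof (rule integral_dominated_convergence[where w = "\<lambda>t. cmod (phi t)"])
    show "AE t in lborel. (\<lambda>k. iexp (- (t \<bullet> x)) * complex_of_real (exp (- (norm ((1 / real (Suc k)) *\<^sub>R t))\<^sup>2 / 2)) * phi t)
        \<longlonglongrightarrow> iexp (- (t \<bullet> x)) * phi t"
    proof (rule AE_I2)
      fix t :: 'a
      have "(\<lambda>k. iexp (- (t \<bullet> x)) * complex_of_real (exp (- (norm ((1 / real (Suc k)) *\<^sub>R t))\<^sup>2 / 2)) * phi t)
        \<longlonglongrightarrow> iexp (- (t \<bullet> x)) * complex_of_real (exp (- (norm (0 *\<^sub>R t))\<^sup>2 / 2)) * phi t"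
        by (intro tendsto_intros LIMSEQ_Suc[OF lim_1_over_n]) simp
      then show "(\<lambda>k. iexp (- (t \<bullet> x)) * complex_of_real (exp (- (norm ((1 / real (Suc k)) *\<^sub>R t))\<^sup>2 / 2)) * phi t)
        \<longlonglongrightarrow> iexp (- (t \<bullet> x)) * phi t" by simp
    qed
    show "AE t in lborel. norm (iexp (- (t \<bullet> x)) * complex_of_real (exp (- (norm ((1 / real (Suc k)) *\<^sub>R t))\<^sup>2 / 2)) * phi t) \<le> cmod (phi t)" for k
      by (intro AE_I2) (simp add: norm_mult mult_left_le_one_le)
  qed (use phi_int in simp_all)
  then have "(\<lambda>k. Re (?F k) / (2 * pi) ^ DIM('a)) \<longlonglongrightarrow> inv_phi x"
    unfolding inv_phi_def by (intro tendsto_intros) auto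
  then show ?thesis
    by (subst smoothed_eq_Re) simp_all
qed

text \<open>The sign cannot be read off the oscillating inversion integral; it is inherited from the
  smoothed densities.\<close>

lemma inv_phi_nonneg: "0 \<le> inv_phi x"
  by (rule LIMSEQ_le_const[OF smoothed_tendsto]) (auto intro!: smoothed_nonneg)

text \<open>The bound does not depend on \<epsilon>; it is the majorant for the passage to the limit
  on bounded boxes.\<close>

lemma smoothed_le:
  assumes "\<epsilon> > 0"
  shows "smoothed \<epsilon> x \<le> (LINT t|lborel. cmod (phi t)) / (2 * pi) ^ DIM('a)"
proof -
  let ?h = "\<lambda>t. iexp (- (t \<bullet> x)) * complex_of_real (exp (- (norm (\<epsilon> *\<^sub>R t))\<^sup>2 / 2)) * phi t"
  have "Re (CLINT t|lborel. ?h t) \<le> (LINT t|lborel. cmod (?h t))"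
    using complex_Re_le_cmod integral_norm_bound order_trans by blast
  also have "\<dots> \<le> (LINT t|lborel. cmod (phi t))"
  proof (rule integral_mono)
    have le: "cmod (?h t) \<le> cmod (phi t)" for t
      by (simp add: norm_mult mult_left_le_one_le)
    show "cmod (?h t) \<le> cmod (phi t)" for t by (rule le)
    show "integrable lborel (\<lambda>t. cmod (?h t))"
      using phi_int by (intro integrable_norm Bochner_Integration.integrable_bound[OF phi_int]) (use le in auto)
  qed (use phi_int in simp)
  finally show ?thesis
    unfolding smoothed_eq_Re[OF assms] by (intro divide_right_mono) auto
qed

text \<open>Both sides are limits of the same integrals of \<open>g\<close> against the smoothed
  densities: one by weak convergence, the other by pointwise convergence of these densities to
  \<open>inv_phi\<close>, dominated by a constant on the box.\<close>

lemma nn_integral_inv_phi_test: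
  fixes g :: "'a \<Rightarrow> real"
  assumes g: "continuous_on UNIV g" "\<And>x. 0 \<le> g x" "\<And>x. g x \<le> indicator (box a b) x"
  shows "(\<integral>\<^sup>+x. ennreal (g x) \<partial>M) = (\<integral>\<^sup>+x. ennreal (inv_phi x) * ennreal (g x) \<partial>lborel)"
proof (rule LIMSEQ_unique)
  have [measurable]: "g \<in> borel_measurable borel"
    using g(1) by (rule borel_measurable_continuous_onI)
  have "g x \<le> 1" for x by (rule order_trans[OF g(3)]) (simp add: indicator_le_1)
  then show "(\<lambda>k. \<integral>\<^sup>+x. ennreal (g x) * ennreal (smoothed (1 / real (Suc k)) x) \<partial>lborel)
    \<longlonglongrightarrow> (\<integral>\<^sup>+y. ennreal (g y) \<partial>M)"
    by (intro nn_integral_smoothed_tendsto g)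
  define C where "C = (LINT t|lborel. cmod (phi t)) / (2 * pi) ^ DIM('a)"
  show "(\<lambda>k. \<integral>\<^sup>+x. ennreal (g x) * ennreal (smoothed (1 / real (Suc k)) x) \<partial>lborel)
    \<longlonglongrightarrow> (\<integral>\<^sup>+x. ennreal (inv_phi x) * ennreal (g x) \<partial>lborel)"
  proof (rule nn_integral_dominated_convergence[where w = "\<lambda>x. ennreal C * indicator (box a b) x"])
    show "AE x in lborel. ennreal (g x) * ennreal (smoothed (1 / real (Suc k)) x) \<le> ennreal C * indicator (box a b) x" for k
    proof (rule AE_I2)
      fix x
      have "ennreal (g x) \<le> indicator (box a b) x"
        using ennreal_leI[OF g(3)[of x]] by (simp add: ennreal_indicator)
      then show "ennreal (g x) * ennreal (smoothed (1 / real (Suc k)) x) \<le> ennreal C * indicator (box a b) x"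
        using smoothed_le[of "1 / real (Suc k)" x]
        by (subst mult.commute, intro mult_mono) (auto simp: C_def intro!: ennreal_leI)
    qed
    show "AE x in lborel. (\<lambda>k. ennreal (g x) * ennreal (smoothed (1 / real (Suc k)) x))
        \<longlonglongrightarrow> ennreal (inv_phi x) * ennreal (g x)"
      by (subst mult.commute, intro AE_I2 tendsto_mult_ennreal tendsto_ennrealI tendsto_const smoothed_tendsto) simp_all
    have "(\<integral>\<^sup>+x. ennreal C * indicator (box a b) x \<partial>lborel) = ennreal C * emeasure lborel (box a b)"
      by (rule nn_integral_cmult_indicator) simp
    then show "(\<integral>\<^sup>+x. ennreal C * indicator (box a b) x \<partial>lborel) < \<infinity>"
      using emeasure_lborel_box_finite[of a b] by (simp add: ennreal_mult_less_top)
  qed (simp_all add: borel_measurable_indicator)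
qed

text \<open>The indicator of the open box is the limit of the continuous ramps \<open>g k\<close>: a
  point of the box has positive distance to the complement, so the ramps eventually equal 1
  there.\<close>

lemma emeasure_box_inv_phi: "emeasure M (box a b) = emeasure (density lborel (\<lambda>x. ennreal (inv_phi x))) (box a b)"
proof (rule LIMSEQ_unique)
  define g where "g k x = min 1 (real k * infdist x (- box a b))" for k :: nat and x
  let ?D = "density lborel (\<lambda>x. ennreal (inv_phi x))"
  \<comment> \<open>The distance to the empty set is 0 by convention, so the ramps would vanish if
    the complement were empty.\<close>
  have ne: "- box a b \<noteq> {}"
    using not_bounded_UNIV bounded_box[of a b] by (metis Compl_empty_eq double_complement)
  have cont: "continuous_on UNIV (g k)" for k
    unfolding g_def by (intro continuous_intros continuous_on_infdist)
  have [measurable]: "g k \<in> borel_measurable borel" for k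
    using cont by (rule borel_measurable_continuous_onI)
  have nn: "0 \<le> g k x" for k x
    by (simp add: g_def infdist_nonneg)
  have le: "g k x \<le> indicator (box a b) x" for k x
    by (auto simp: g_def indicator_def infdist_zero)
  have inc: "(\<lambda>k. ennreal (g k x)) \<longlonglongrightarrow> indicator (box a b) x" for x
  proof (cases "x \<in> box a b")
    case True
    have "infdist x (- box a b) > 0"
      using True ne in_closed_iff_infdist_zero[of "- box a b" x] infdist_nonneg[of x "- box a b"]
      by (auto simp: open_box less_le)
    then obtain n where "1 \<le> real n * infdist x (- box a b)"
      by (metis reals_Archimedean3 less_imp_le)
    moreover have "real n * infdist x (- box a b) \<le> real k * infdist x (- box a b)" if "n \<le> k" for k
      using that by (intro mult_right_mono) (auto simp: infdist_nonneg)
    ultimately have "g k x = 1" if "n \<le> k" for k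
      using that by (fastforce simp: g_def)
    then show ?thesis
      using True by (intro tendsto_eventually eventually_sequentiallyI[of n]) simp
  next
    case False
    then have "g k x = 0" for k by (simp add: g_def)
    then show ?thesis using False by simp
  qed
  have lim: "(\<lambda>k. \<integral>\<^sup>+x. ennreal (g k x) \<partial>N) \<longlonglongrightarrow> emeasure N (box a b)"
    if [measurable_cong]: "sets N = sets borel" and "emeasure N (box a b) < \<infinity>" for N
  proof -
    have "(\<lambda>k. \<integral>\<^sup>+x. ennreal (g k x) \<partial>N) \<longlonglongrightarrow> (\<integral>\<^sup>+x. indicator (box a b) x \<partial>N)"
    proof (rule nn_integral_dominated_convergence[where w = "indicator (box a b)"])
      show "AE x in N. ennreal (g k x) \<le> indicator (box a b) x" for k
        using ennreal_leI[OF le] by (simp add: ennreal_indicator)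
    qed (use that inc in \<open>simp_all add: borel_measurable_indicator\<close>)
    then show ?thesis using that by simp
  qed
  show "(\<lambda>k. \<integral>\<^sup>+x. ennreal (g k x) \<partial>M) \<longlonglongrightarrow> emeasure M (box a b)"
    by (rule lim) (simp_all add: sets_M emeasure_finite less_top[symmetric])
  \<comment> \<open>Dominated convergence under \<open>?D\<close> needs a box of finite mass. The
    uniform bound on the smoothed densities passes to their limit \<open>inv_phi\<close> and
    supplies it.\<close>
  have "emeasure ?D (box a b) \<le> (\<integral>\<^sup>+x. ennreal ((LINT t|lborel. cmod (phi t)) / (2 * pi) ^ DIM('a)) * indicator (box a b) x \<partial>lborel)"
  proof -
    have "inv_phi x \<le> (LINT t|lborel. cmod (phi t)) / (2 * pi) ^ DIM('a)" for x
      by (rule LIMSEQ_le_const2[OF smoothed_tendsto]) (intro exI[of _ 0] allI impI smoothed_le, simp)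
    then show ?thesis
      by (subst emeasure_density) (auto intro!: nn_integral_mono mult_right_mono ennreal_leI)
  qed
  also have "\<dots> < \<infinity>"
    using emeasure_lborel_box_finite[of a b] by (subst nn_integral_cmult_indicator) (simp_all add: ennreal_mult_less_top)
  finally have "(\<lambda>k. \<integral>\<^sup>+x. ennreal (g k x) \<partial>?D) \<longlonglongrightarrow> emeasure ?D (box a b)"
    by (intro lim) simp_all
  moreover have "(\<integral>\<^sup>+x. ennreal (g k x) \<partial>?D) = (\<integral>\<^sup>+x. ennreal (g k x) \<partial>M)" for k
    unfolding nn_integral_inv_phi_test[OF cont nn le] by (subst nn_integral_density) simp_all
  ultimately show "(\<lambda>k. \<integral>\<^sup>+x. ennreal (g k x) \<partial>M) \<longlonglongrightarrow> emeasure ?D (box a b)"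
    by simp
qed

lemma density_inv_phi: "density lborel (\<lambda>x. ennreal (inv_phi x)) = M"
proof (rule sym, rule measure_eqI_generator_eq)
  let ?E = "range (\<lambda>(a, b). box a b :: 'a set)"
  show "Int_stable ?E"
    by (auto simp: Int_stable_def box_Int_box)
  show "?E \<subseteq> Pow UNIV" "sets M = sigma_sets UNIV ?E"
    "sets (density lborel (\<lambda>x. ennreal (inv_phi x))) = sigma_sets UNIV ?E"
    by (simp_all add: borel_eq_box sets_M)
  let ?A = "\<lambda>n::nat. box (- (real n *\<^sub>R One)) (real n *\<^sub>R One) :: 'a set"
  show "range ?A \<subseteq> ?E" "(\<Union>i. ?A i) = UNIV"
    unfolding UN_box_eq_UNIV by auto
  show "emeasure M (?A i) \<noteq> \<infinity>" for i by simp
  show "emeasure M X = emeasure (density lborel (\<lambda>x. ennreal (inv_phi x))) X" if "X \<in> ?E" for X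
    using that emeasure_box_inv_phi by auto
qed

end

end

section \<open>Bias and second moment of the kernel\<close>

text \<open>The radial part of Lebesgue measure up to the cutoff. As a finite measure it makes all
  bounded integrands integrable, so Fubini applies freely to products of cosines.\<close>

definition disc_measure :: "nat \<Rightarrow> real \<Rightarrow> real measure" where
  "disc_measure d m = density lborel (\<lambda>r. ennreal (r ^ (d - 1) * indicator {0..m} r))"

lemma sets_disc_measure[measurable_cong, simp]: "sets (disc_measure d m) = sets borel"
  by (simp add: disc_measure_def)

text \<open>Trading the weight for its largest value brings back Lebesgue measure, whose translation
  and reflection invariance the variance bound exploits.\<close>

lemma nn_integral_disc_measure_le:
  assumes "m \<ge> 0" and [measurable]: "g \<in> borel_measurable borel"
  shows "(\<integral>\<^sup>+r. g r \<partial>disc_measure d m) \<le> ennreal (m ^ (d - 1)) * (\<integral>\<^sup>+r. g r * indicator {0..m} r \<partial>lborel)"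
proof -
  have "(\<integral>\<^sup>+r. g r \<partial>disc_measure d m) = (\<integral>\<^sup>+r. ennreal (r ^ (d - 1) * indicator {0..m} r) * g r \<partial>lborel)"
    unfolding disc_measure_def by (subst nn_integral_density) simp_all
  also have "\<dots> \<le> (\<integral>\<^sup>+r. ennreal (m ^ (d - 1)) * (g r * indicator {0..m} r) \<partial>lborel)"
  proof (rule nn_integral_mono)
    fix r :: real
    show "ennreal (r ^ (d - 1) * indicator {0..m} r) * g r \<le> ennreal (m ^ (d - 1)) * (g r * indicator {0..m} r)"
      by (auto split: split_indicator intro!: mult_right_mono ennreal_leI power_mono)
  qed
  also have "\<dots> = ennreal (m ^ (d - 1)) * (\<integral>\<^sup>+r. g r * indicator {0..m} r \<partial>lborel)"
    by (rule nn_integral_cmult) simp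
  finally show ?thesis .
qed

lemma finite_measure_disc_measure:
  assumes "m \<ge> 0"
  shows "finite_measure (disc_measure d m)"
proof (rule finite_measureI)
  have "emeasure (disc_measure d m) (space (disc_measure d m)) \<le> ennreal (m ^ (d - 1)) * emeasure lborel {0..m}"
    using nn_integral_disc_measure_le[OF assms, of "\<lambda>_. 1" d] by simp
  also have "\<dots> < \<infinity>" using assms by (simp add: ennreal_mult_less_top)
  finally show "emeasure (disc_measure d m) (space (disc_measure d m)) \<noteq> \<infinity>" by simp
qed

lemma kernel_eq: "kernel d m w = rho d / (2 * pi) ^ d * (LINT r|disc_measure d m. cos (w * r))"
  unfolding kernel_def disc_measure_def set_lebesgue_integral_def
  by (subst integral_density) (auto simp: mult_ac split: split_indicator)

lemma borel_measurable_kernel[measurable]: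
  assumes "m \<ge> 0"
  shows "kernel d m \<in> borel_measurable borel"
proof -
  interpret finite_measure "disc_measure d m" by (rule finite_measure_disc_measure[OF assms])
  show ?thesis unfolding kernel_eq[abs_def] by measurable
qed

lemma kernel_bounded:
  assumes "m \<ge> 0"
  shows "\<exists>B. \<forall>w. \<bar>kernel d m w\<bar> \<le> B"
proof -
  interpret finite_measure "disc_measure d m" by (rule finite_measure_disc_measure[OF assms])
  have "\<bar>LINT r|disc_measure d m. cos (w * r)\<bar> \<le> measure (disc_measure d m) (space (disc_measure d m))" for w
  proof -
    have "\<bar>LINT r|disc_measure d m. cos (w * r)\<bar> \<le> (LINT r|disc_measure d m. \<bar>cos (w * r)\<bar>)"
      by (rule integral_abs_bound)
    also have "\<dots> \<le> (LINT r|disc_measure d m. 1)"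
      by (intro integral_mono integrable_const_bound[where B = 1] AE_I2) simp_all
    finally show ?thesis by simp
  qed
  then have "\<bar>kernel d m w\<bar> \<le> \<bar>rho d / (2 * pi) ^ d\<bar> * measure (disc_measure d m) (space (disc_measure d m))" for w
    unfolding kernel_eq abs_mult by (intro mult_left_mono) auto
  then show ?thesis by blast
qed

lemma nn_integral_even_line:
  fixes g :: "real \<Rightarrow> ennreal"
  assumes [measurable]: "g \<in> borel_measurable borel" and "\<And>r. g (- r) = g r"
  shows "(\<integral>\<^sup>+r. g r \<partial>lborel) = 2 * (\<integral>\<^sup>+r. g r * indicator {0<..} r \<partial>lborel)"
proof -
  have "(\<integral>\<^sup>+r. g r \<partial>lborel) = (\<integral>\<^sup>+r. g r * indicator {0<..} r + g r * indicator {..<0} r \<partial>lborel)"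
    using AE_lborel_singleton[of "0 :: real"]
    by (intro nn_integral_cong_AE) (auto elim!: eventually_mono split: split_indicator)
  also have "\<dots> = (\<integral>\<^sup>+r. g r * indicator {0<..} r \<partial>lborel) + (\<integral>\<^sup>+r. g r * indicator {..<0} r \<partial>lborel)"
    by (rule nn_integral_add) simp_all
  also have "(\<integral>\<^sup>+r. g r * indicator {..<0} r \<partial>lborel) = (\<integral>\<^sup>+r. g (0 - r) * indicator {..<0} (0 - r) \<partial>lborel)"
    by (rule nn_integral_lborel_reflect[symmetric]) simp
  also have "\<dots> = (\<integral>\<^sup>+r. g r * indicator {0<..} r \<partial>lborel)"
    by (intro nn_integral_cong) (auto simp: assms(2) split: split_indicator)
  finally show ?thesis by (simp add: mult_2)
qed

lemma borel_measurable_observation_law: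
  "H \<in> borel \<Otimes>\<^sub>M borel \<rightarrow>\<^sub>M N \<Longrightarrow> H \<in> observation_law (f :: real^'d::finite \<Rightarrow> real) \<rightarrow>\<^sub>M N"
  using borel_measurable_sphere_measure_pair[of H N borel] measurable_cong_sets[OF sets_observation_law refl]
  by blast

section \<open>Expectations under the law of an observation\<close>

locale radon_density =
  fixes f :: "real^'d::finite \<Rightarrow> real"
  assumes density: "prob_density f"
begin

abbreviation P :: "(real^'d) measure" where
  "P \<equiv> density lborel (\<lambda>y. ennreal (f y))"

sublocale P: euclidean_prob P
  by (intro euclidean_prob.intro prob_densityD(4)[OF density] euclidean_prob_axioms.intro) simp

lemma fourier_eq_phi: "fourier (\<lambda>y. complex_of_real (f y)) = P.phi"
  by (simp add: fun_eq_iff fourier_eq_density[OF density] P.phi_def)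

lemma cmod_phi_minus: "cmod (P.phi (- t)) = cmod (P.phi t)"
proof -
  have "iexp (- t \<bullet> y) = cnj (iexp (t \<bullet> y))" for y
    by (simp add: exp_cnj)
  then have "P.phi (- t) = cnj (P.phi t)"
    unfolding P.phi_def by (simp only: Bochner_Integration.integral_cnj)
  then show ?thesis by simp
qed

lemma integral_cos: "(LINT v|P. cos (t \<bullet> v - a)) = Re (iexp (- a) * P.phi t)"
proof -
  have "integrable P (\<lambda>v. iexp (- a) * iexp (t \<bullet> v))"
    by (intro P.integrable_const_bound[where B = 1]) (simp_all add: norm_mult)
  then have "(LINT v|P. Re (iexp (- a) * iexp (t \<bullet> v))) = Re (CLINT v|P. iexp (- a) * iexp (t \<bullet> v))"
    by (rule integral_Re)
  moreover have "Re (iexp (- a) * iexp (t \<bullet> v)) = cos (t \<bullet> v - a)" for v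
    unfolding exp_add[symmetric] by (simp add: Re_exp)
  ultimately show ?thesis
    by (simp add: P.phi_def)
qed

lemma abs_integral_cos_le: "\<bar>LINT v|P. cos (t \<bullet> v - a)\<bar> \<le> cmod (P.phi t)"
proof -
  have "\<bar>LINT v|P. cos (t \<bullet> v - a)\<bar> \<le> cmod (iexp (- a) * P.phi t)"
    unfolding integral_cos by (rule abs_Re_le_cmod)
  then show ?thesis by (simp add: norm_mult)
qed

lemma nn_integral_observation_law_P:
  assumes [measurable]: "H \<in> borel_measurable (borel \<Otimes>\<^sub>M borel)"
  shows "(\<integral>\<^sup>+p. H p \<partial>observation_law f)
    = ennreal (1 / rho CARD('d)) * (\<integral>\<^sup>+s. \<integral>\<^sup>+v. H (s, v \<bullet> s) \<partial>P \<partial>sphere_measure)"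
  unfolding nn_integral_observation_law[OF density assms]
  using prob_densityD(1)[OF density] by (simp add: nn_integral_density)

text \<open>The nonnegative formula is first upgraded to an identity of measures, so that it covers
  signed \<open>H\<close>; boundedness then allows iterated integration over the finite product
  measure.\<close>

lemma integral_observation_law:
  fixes H :: "(real^'d) \<times> real \<Rightarrow> real"
  assumes [measurable]: "H \<in> borel_measurable (borel \<Otimes>\<^sub>M borel)" and bound: "\<And>p. \<bar>H p\<bar> \<le> B"
  shows "(LINT p|observation_law f. H p) = 1 / rho CARD('d) * (LINT s|sphere_measure. LINT v|P. H (s, v \<bullet> s))"
proof -
  let ?S = "sphere_measure :: (real^'d) measure" and ?rho = "rho CARD('d)"
  interpret S: finite_measure ?S by (rule finite_measure_sphere_measure)
  interpret SP: pair_sigma_finite ?S P by unfold_locales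
  interpret SPf: finite_measure "?S \<Otimes>\<^sub>M P"
    by (intro finite_measure_pair_measure S.finite_measure_axioms P.finite_measure_axioms)
  let ?T = "\<lambda>(s, v :: real^'d). (s, v \<bullet> s)"
  have T: "?T \<in> ?S \<Otimes>\<^sub>M P \<rightarrow>\<^sub>M ?S \<Otimes>\<^sub>M borel"
  proof (rule measurable_pair)
    have "(\<lambda>p. snd p \<bullet> fst p) \<in> borel_measurable (?S \<Otimes>\<^sub>M P)"
      by (rule borel_measurable_sphere_measure_pair) simp_all
    then show "snd \<circ> ?T \<in> ?S \<Otimes>\<^sub>M P \<rightarrow>\<^sub>M borel"
      by (simp add: o_def case_prod_beta)
  qed (simp add: o_def case_prod_beta)
  have H: "H \<in> borel_measurable (?S \<Otimes>\<^sub>M borel)"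
    by (rule borel_measurable_sphere_measure_pair) simp_all
  have law: "observation_law f = density (distr (?S \<Otimes>\<^sub>M P) (?S \<Otimes>\<^sub>M borel) ?T) (\<lambda>_. ennreal (1 / ?rho))"
  proof (rule measure_eqI)
    fix A assume "A \<in> sets (observation_law f)"
    then have A: "A \<in> sets (?S \<Otimes>\<^sub>M borel)" by (simp add: sets_observation_law)
    then have "A \<in> sets (restrict_space borel (sphere 0 1) \<Otimes>\<^sub>M borel)"
      by (simp cong: sets_pair_measure_cong add: sets_sphere_measure)
    \<comment> \<open>The sphere is closed, so sets measurable for the trace are Borel in the
      ambient product, as the nonnegative formula expects.\<close>
    then have A': "A \<in> sets (borel \<Otimes>\<^sub>M borel)"
    proof (rule rev_subsetD)
      show "sets (restrict_space borel (sphere (0 :: real^'d) 1) \<Otimes>\<^sub>M (borel :: real measure)) \<subseteq> sets (borel \<Otimes>\<^sub>M borel)"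
        unfolding sets_pair_measure[of "restrict_space borel (sphere (0 :: real^'d) 1)"]
      proof (rule sets.sigma_sets_subset')
        show "space (restrict_space borel (sphere (0 :: real^'d) 1)) \<times> space (borel :: real measure) \<in> sets (borel \<Otimes>\<^sub>M borel)"
          by (intro pair_measureI) (simp_all add: space_restrict_space)
        have "a \<in> sets borel" if "a \<in> sets (restrict_space borel (sphere (0 :: real^'d) 1))" for a
          using that by (subst (asm) sets_restrict_space_iff) simp_all
        then show "{a \<times> b |a b. a \<in> sets (restrict_space borel (sphere (0 :: real^'d) 1)) \<and> b \<in> sets (borel :: real measure)}
            \<subseteq> sets (borel \<Otimes>\<^sub>M borel)"
          by (auto intro!: pair_measureI)
      qed
    qed
    have "emeasure (observation_law f) A = (\<integral>\<^sup>+p. indicator A p \<partial>observation_law f)"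
      using A by (simp add: sets_observation_law)
    also have "\<dots> = ennreal (1 / ?rho) * (\<integral>\<^sup>+s. \<integral>\<^sup>+v. indicator A (s, v \<bullet> s) \<partial>P \<partial>?S)"
      by (rule nn_integral_observation_law_P) (use A' in simp)
    also have "(\<integral>\<^sup>+s. \<integral>\<^sup>+v. indicator A (s, v \<bullet> s) \<partial>P \<partial>?S) = (\<integral>\<^sup>+p. indicator A (?T p) \<partial>(?S \<Otimes>\<^sub>M P))"
      by (subst P.nn_integral_fst[symmetric]) (use measurable_compose[OF T borel_measurable_indicator[OF A]] in simp_all)
    also have "\<dots> = emeasure (distr (?S \<Otimes>\<^sub>M P) (?S \<Otimes>\<^sub>M borel) ?T) A"
      using A T by (simp add: nn_integral_distr[symmetric])
    finally show "emeasure (observation_law f) A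
        = emeasure (density (distr (?S \<Otimes>\<^sub>M P) (?S \<Otimes>\<^sub>M borel) ?T) (\<lambda>_. ennreal (1 / ?rho))) A"
      using A by (simp add: emeasure_density nn_integral_cmult_indicator)
  qed (simp add: sets_observation_law)
  have "(LINT p|observation_law f. H p) = 1 / ?rho * (LINT p|(?S \<Otimes>\<^sub>M P). H (?T p))"
    unfolding law using H T rho_pos[of "CARD('d)"]
    by (subst integral_density) (simp_all add: integral_distr)
  also have "(LINT p|(?S \<Otimes>\<^sub>M P). H (?T p)) = (LINT s|?S. LINT v|P. H (?T (s, v)))"
    by (rule SP.integral_fst'[symmetric])
      (intro SPf.integrable_const_bound[where B = B] AE_I2 measurable_compose[OF T H], simp add: bound)
  finally show ?thesis by simp
qed

text \<open>A cosine of frequency \<open>r\<close> in the projection onto \<open>s\<close> is a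
  plane wave at the frequency vector \<open>r *\<^sub>R s\<close>; averaging it over
  \<open>P\<close> produces \<open>phi\<close> there, on the ray used by polar coordinates.\<close>

lemma integral_kernel_line:
  assumes "m \<ge> 0"
  shows "(LINT v|P. kernel CARD('d) m (s \<bullet> x - v \<bullet> s))
    = rho CARD('d) / (2 * pi) ^ CARD('d) * (LINT r|disc_measure CARD('d) m. Re (iexp (- ((r *\<^sub>R s) \<bullet> x)) * P.phi (r *\<^sub>R s)))"
proof -
  let ?D = "disc_measure CARD('d) m"
  interpret D: finite_measure ?D by (rule finite_measure_disc_measure[OF assms])
  interpret PD: pair_sigma_finite P ?D by unfold_locales
  interpret PDf: finite_measure "P \<Otimes>\<^sub>M ?D"
    by (intro finite_measure_pair_measure D.finite_measure_axioms P.finite_measure_axioms)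
  have "(LINT v|P. LINT r|?D. cos ((s \<bullet> x - v \<bullet> s) * r)) = (LINT r|?D. LINT v|P. cos ((s \<bullet> x - v \<bullet> s) * r))"
    by (rule PD.Fubini_integral[symmetric])
       (intro PDf.integrable_const_bound[where B = 1] AE_I2, auto)
  also have "\<dots> = (LINT r|?D. LINT v|P. cos ((r *\<^sub>R s) \<bullet> v - (r *\<^sub>R s) \<bullet> x))"
  proof -
    have "cos ((s \<bullet> x - v \<bullet> s) * r) = cos ((r *\<^sub>R s) \<bullet> v - (r *\<^sub>R s) \<bullet> x)" for r v
      by (subst cos_minus[symmetric]) (simp add: algebra_simps inner_commute)
    then show ?thesis by simp
  qed
  also have "\<dots> = (LINT r|?D. Re (iexp (- ((r *\<^sub>R s) \<bullet> x)) * P.phi (r *\<^sub>R s)))"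
    unfolding integral_cos ..
  finally show ?thesis by (simp add: kernel_eq)
qed

context
  assumes phi_int: "integrable lborel P.phi"
begin

text \<open>\<open>f\<close> and \<open>inv_phi\<close> are densities of the same measure, hence
  equal almost everywhere, and \<open>inv_phi\<close> is continuous.\<close>

lemma continuous_version_eq: "continuous_version f = P.inv_phi"
  unfolding continuous_version_def
proof (rule the_equality)
  have "AE y in lborel. ennreal (P.inv_phi y) = ennreal (f y)"
    using P.density_inv_phi[OF phi_int] prob_densityD(1)[OF density] P.borel_measurable_inv_phi[OF phi_int]
    by (subst (asm) sigma_finite_measure.density_unique_iff[OF sigma_finite_lborel]) simp_all
  then have "AE y in lborel. P.inv_phi y = f y"
    using prob_densityD(2)[OF density] P.inv_phi_nonneg[OF phi_int] by (auto elim!: eventually_mono)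
  then show *: "continuous_on UNIV P.inv_phi \<and> (AE y in lborel. P.inv_phi y = f y)"
    using P.continuous_inv_phi[OF phi_int] by simp
  fix g assume "continuous_on UNIV g \<and> (AE y in lborel. g y = f y)"
  then show "g = P.inv_phi"
    using * by (intro continuous_AE_eq) (auto elim: eventually_elim2)
qed

text \<open>The factor \<open>rho\<close> of the kernel cancels the normalisation of the observation
  law, and the power of r in the kernel is the polar Jacobian. What remains is the inversion
  integral over the ball of radius \<open>m\<close>.\<close>

lemma expectation_kernel:
  assumes "m \<ge> 0"
  shows "(LINT p|observation_law f. kernel CARD('d) m (fst p \<bullet> x - snd p))
    = (LINT t|lborel. indicator (cball 0 m) t * Re (iexp (- (t \<bullet> x)) * P.phi t)) / (2 * pi) ^ CARD('d)"
proof -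
  let ?d = "CARD('d)" and ?S = "sphere_measure :: (real^'d) measure"
  define h where "h t = Re (iexp (- (t \<bullet> x)) * P.phi t)" for t
  have h_meas[measurable]: "h \<in> borel_measurable borel" unfolding h_def by measurable
  have ind[measurable]: "indicat_real (cball 0 m) \<in> borel_measurable (borel :: (real^'d) measure)"
    by (rule borel_measurable_indicator) simp
  note borel_measurable_kernel[OF assms, measurable]
  obtain B where B: "\<And>w. \<bar>kernel ?d m w\<bar> \<le> B" using kernel_bounded[OF assms] by blast
  interpret R: sigma_finite_measure "radial_measure ?d" by (rule sigma_finite_radial_measure)
  interpret S: finite_measure ?S by (rule finite_measure_sphere_measure)
  interpret SR: pair_sigma_finite ?S "radial_measure ?d" by unfold_locales
  let ?T = "\<lambda>(s, r). r *\<^sub>R (s :: real^'d)"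
  have T: "?T \<in> ?S \<Otimes>\<^sub>M radial_measure ?d \<rightarrow>\<^sub>M borel"
    by (intro borel_measurable_sphere_measure_pair) simp_all
  have h_int: "integrable lborel (\<lambda>t. indicator (cball 0 m) t * h t)"
  proof (rule Bochner_Integration.integrable_bound[OF phi_int])
    have "\<bar>h t\<bar> \<le> cmod (P.phi t)" for t
      unfolding h_def by (rule order_trans[OF abs_Re_le_cmod]) (simp add: norm_mult)
    then show "AE t in lborel. norm (indicator (cball 0 m) t * h t) \<le> norm (P.phi t)"
      by (auto split: split_indicator)
  qed simp
  have "(LINT t|lborel. indicator (cball 0 m) t * h t)
      = (LINT p|(?S \<Otimes>\<^sub>M radial_measure ?d). indicator (cball 0 m) (?T p) * h (?T p))"
    by (subst lborel_eq_polar, subst integral_distr[OF T]) simp_all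
  also have "\<dots> = (LINT s|?S. LINT r|radial_measure ?d. indicator (cball 0 m) (?T (s, r)) * h (?T (s, r)))"
  proof (rule SR.integral_fst'[symmetric])
    have "integrable (distr (?S \<Otimes>\<^sub>M radial_measure ?d) borel ?T) (\<lambda>t. indicator (cball 0 m) t * h t)"
      using h_int by (simp flip: lborel_eq_polar)
    then show "integrable (?S \<Otimes>\<^sub>M radial_measure ?d) (\<lambda>p. indicator (cball 0 m) (?T p) * h (?T p))"
      by (subst (asm) integrable_distr_eq[OF T]) simp_all
  qed
  also have "\<dots> = (LINT s|?S. LINT r|disc_measure ?d m. h (r *\<^sub>R s))"
  proof (rule Bochner_Integration.integral_cong[OF refl])
    fix s assume "s \<in> space ?S"
    then have s: "norm s = 1" by (simp add: space_sphere_measure)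
    have rm: "radial_measure ?d = density lborel (\<lambda>r. ennreal (r ^ (?d - 1) * indicator {0<..} r))"
      unfolding radial_measure_def by (intro density_cong AE_I2) (auto split: split_indicator)
    have "(LINT r|radial_measure ?d. indicator (cball 0 m) (r *\<^sub>R s) * h (r *\<^sub>R s))
        = (LINT r|lborel. (r ^ (?d - 1) * indicator {0<..} r) *\<^sub>R (indicator (cball 0 m) (r *\<^sub>R s) * h (r *\<^sub>R s)))"
      unfolding rm by (subst integral_density) (auto split: split_indicator)
    \<comment> \<open>On a unit direction the ball cuts the radius at \<open>m\<close>; the two
      ranges of \<open>r\<close> differ at most in the point 0.\<close>
    also have "\<dots> = (LINT r|lborel. (r ^ (?d - 1) * indicator {0..m} r) *\<^sub>R h (r *\<^sub>R s))"
      using AE_lborel_singleton[of "0 :: real"] s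
      by (intro integral_cong_AE) (auto elim!: eventually_mono split: split_indicator)
    also have "\<dots> = (LINT r|disc_measure ?d m. h (r *\<^sub>R s))"
      unfolding disc_measure_def by (subst integral_density) (auto split: split_indicator)
    finally show "(LINT r|radial_measure ?d. indicator (cball 0 m) (?T (s, r)) * h (?T (s, r)))
        = (LINT r|disc_measure ?d m. h (r *\<^sub>R s))" by simp
  qed
  finally have polar: "(LINT t|lborel. indicator (cball 0 m) t * h t) = (LINT s|?S. LINT r|disc_measure ?d m. h (r *\<^sub>R s))" .
  have "(LINT p|observation_law f. kernel ?d m (fst p \<bullet> x - snd p))
      = 1 / rho ?d * (LINT s|?S. LINT v|P. kernel ?d m (s \<bullet> x - v \<bullet> s))"
    by (subst integral_observation_law[where B = B]) (simp_all add: B)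
  also have "\<dots> = 1 / rho ?d * (rho ?d / (2 * pi) ^ ?d * (LINT s|?S. LINT r|disc_measure ?d m. h (r *\<^sub>R s)))"
    unfolding integral_kernel_line[OF assms] h_def[symmetric] by simp
  also have "\<dots> = (LINT t|lborel. indicator (cball 0 m) t * h t) / (2 * pi) ^ ?d"
    unfolding polar using rho_pos[of ?d] by simp
  finally show ?thesis unfolding h_def .
qed

lemma bias_le:
  assumes "m \<ge> 0" and tail: "(\<integral>\<^sup>+t. ennreal (cmod (P.phi t)) * indicator {t. m < norm t} t \<partial>lborel) \<le> ennreal T" "T \<ge> 0"
  shows "\<bar>(LINT p|observation_law f. kernel CARD('d) m (fst p \<bullet> x - snd p)) - P.inv_phi x\<bar> \<le> T / (2 * pi) ^ CARD('d)"
proof -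
  let ?d = "CARD('d)"
  define h where "h t = Re (iexp (- (t \<bullet> x)) * P.phi t)" for t
  have [measurable]: "h \<in> borel_measurable borel" unfolding h_def by measurable
  have ind[measurable]: "indicat_real (cball 0 m) \<in> borel_measurable (borel :: (real^'d) measure)"
    by (rule borel_measurable_indicator) simp
  have h_le: "\<bar>h t\<bar> \<le> cmod (P.phi t)" for t
    unfolding h_def by (rule order_trans[OF abs_Re_le_cmod]) (simp add: norm_mult)
  have h_int: "integrable lborel h"
    by (rule Bochner_Integration.integrable_bound[OF phi_int]) (simp_all add: h_le)
  have hi_int: "integrable lborel (\<lambda>t. indicator (cball 0 m) t * h t)"
    by (rule Bochner_Integration.integrable_bound[OF h_int]) (auto split: split_indicator)
  have inv: "P.inv_phi x = (LINT t|lborel. h t) / (2 * pi) ^ ?d"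
    unfolding P.inv_phi_def h_def by (subst integral_Re[OF P.integrable_inv_phi[OF phi_int]]) simp
  have "ennreal \<bar>(LINT t|lborel. indicator (cball 0 m) t * h t - h t)\<bar>
      \<le> (\<integral>\<^sup>+t. ennreal (norm (indicator (cball 0 m) t * h t - h t)) \<partial>lborel)"
    using integral_norm_bound_ennreal[of lborel "\<lambda>t. indicator (cball 0 m) t * h t - h t"] h_int hi_int by simp
  also have "\<dots> \<le> (\<integral>\<^sup>+t. ennreal (cmod (P.phi t)) * indicator {t. m < norm t} t \<partial>lborel)"
  proof (rule nn_integral_mono)
    fix t
    show "ennreal (norm (indicator (cball 0 m) t * h t - h t)) \<le> ennreal (cmod (P.phi t)) * indicator {t. m < norm t} t"
      using h_le[of t] by (auto split: split_indicator intro!: ennreal_leI)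
  qed
  also note tail(1)
  finally have le: "\<bar>(LINT t|lborel. indicator (cball 0 m) t * h t - h t)\<bar> \<le> T"
    using tail(2) by simp
  have "(LINT p|observation_law f. kernel ?d m (fst p \<bullet> x - snd p)) - P.inv_phi x
      = (LINT t|lborel. indicator (cball 0 m) t * h t - h t) / (2 * pi) ^ ?d"
    unfolding expectation_kernel[OF assms(1)] inv h_def[symmetric] using h_int hi_int
    by (simp add: diff_divide_distrib)
  then show ?thesis
    using le by (simp add: divide_right_mono)
qed

end

text \<open>By \<open>2 cos a cos b = cos (a + b) + cos (a - b)\<close>, averaging the squared kernel over \<open>v\<close> only
  involves \<open>phi\<close> on the line through \<open>s\<close>; this saves a factor \<open>m\<close> over the trivial bound.\<close>

lemma second_moment_line:
  assumes m: "m \<ge> 0"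
  shows "(\<integral>\<^sup>+v. ennreal ((kernel CARD('d) m (s \<bullet> x - v \<bullet> s))\<^sup>2) \<partial>P)
    \<le> ennreal ((rho CARD('d) / (2 * pi) ^ CARD('d))\<^sup>2 * (m ^ (CARD('d) - 1))\<^sup>2 * m) * (\<integral>\<^sup>+r. ennreal (cmod (P.phi (r *\<^sub>R s))) \<partial>lborel)"
proof -
  let ?D = "disc_measure CARD('d) m"
  define c where "c = rho CARD('d) / (2 * pi) ^ CARD('d)"
  define q where "q = m ^ (CARD('d) - 1)"
  define F where "F r = ennreal (cmod (P.phi (r *\<^sub>R s)))" for r
  define I where "I = (\<integral>\<^sup>+r. F r \<partial>lborel)"
  have q: "q \<ge> 0" using m by (simp add: q_def)
  have [measurable]: "F \<in> borel_measurable borel" unfolding F_def by measurable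
  note borel_measurable_kernel[OF m, measurable]
  obtain B where B: "\<And>w. \<bar>kernel CARD('d) m w\<bar> \<le> B" using kernel_bounded[OF m] by blast
  interpret D: finite_measure ?D by (rule finite_measure_disc_measure[OF m])
  interpret DD: pair_sigma_finite ?D ?D by unfold_locales
  interpret DDf: finite_measure "?D \<Otimes>\<^sub>M ?D"
    by (intro finite_measure_pair_measure D.finite_measure_axioms)
  interpret PDD: pair_sigma_finite P "?D \<Otimes>\<^sub>M ?D" by unfold_locales
  interpret PDDf: finite_measure "P \<Otimes>\<^sub>M (?D \<Otimes>\<^sub>M ?D)"
    by (intro finite_measure_pair_measure DDf.finite_measure_axioms P.finite_measure_axioms)
  define w where "w v = s \<bullet> x - v \<bullet> s" for v
  have [measurable]: "w \<in> borel_measurable borel" unfolding w_def by measurable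
  have sq: "(kernel CARD('d) m (w v))\<^sup>2 = c\<^sup>2 * (LINT p|(?D \<Otimes>\<^sub>M ?D). cos (w v * fst p) * cos (w v * snd p))" for v
  proof -
    have "(LINT p|(?D \<Otimes>\<^sub>M ?D). cos (w v * fst p) * cos (w v * snd p))
        = (LINT r|?D. LINT r'|?D. cos (w v * fst (r, r')) * cos (w v * snd (r, r')))"
      by (rule DD.integral_fst'[symmetric])
         (intro DDf.integrable_const_bound[where B = 1] AE_I2, auto simp: abs_mult intro!: mult_le_one)
    then show ?thesis
      by (simp add: kernel_eq c_def power2_eq_square)
  qed
  have int_k: "integrable P (\<lambda>v. (kernel CARD('d) m (w v))\<^sup>2)"
  proof (rule P.integrable_const_bound[where B = "B\<^sup>2"])
    show "AE v in P. norm ((kernel CARD('d) m (w v))\<^sup>2) \<le> B\<^sup>2"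
      using power_mono[OF B abs_ge_zero, of _ 2] by simp
  qed simp
  define E where "E p = (LINT v|P. cos (w v * fst p) * cos (w v * snd p))" for p :: "real \<times> real"
  have [measurable]: "E \<in> borel_measurable (?D \<Otimes>\<^sub>M ?D)" unfolding E_def by measurable
  have E_le: "ennreal \<bar>E (r, r')\<bar> \<le> ennreal (1 / 2) * (F (r + r') + F (r - r'))" for r r'
  proof -
    have eq: "cos (w v * r) * cos (w v * r') = (cos (((r + r') *\<^sub>R s) \<bullet> v - ((r + r') *\<^sub>R s) \<bullet> x)
        + cos (((r - r') *\<^sub>R s) \<bullet> v - ((r - r') *\<^sub>R s) \<bullet> x)) / 2" for v
    proof -
      have "((a *\<^sub>R s) \<bullet> v - (a *\<^sub>R s) \<bullet> x) = - (w v * a)" for a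
        by (simp add: w_def algebra_simps inner_commute)
      then show ?thesis
        by (simp only: cos_minus cos_times_cos) (simp add: algebra_simps)
    qed
    have "E (r, r') = ((LINT v|P. cos (((r + r') *\<^sub>R s) \<bullet> v - ((r + r') *\<^sub>R s) \<bullet> x))
        + (LINT v|P. cos (((r - r') *\<^sub>R s) \<bullet> v - ((r - r') *\<^sub>R s) \<bullet> x))) / 2"
    proof -
      have int: "integrable P (\<lambda>v. cos ((a *\<^sub>R s) \<bullet> v - b))" for a b
        by (intro P.integrable_const_bound[where B = 1] AE_I2) simp_all
      show ?thesis
        unfolding E_def fst_conv snd_conv eq integral_divide_zero
        by (subst Bochner_Integration.integral_add[OF int int]) simp
    qed
    moreover have "\<bar>(a + b) / 2\<bar> \<le> (A + B) / 2" if "\<bar>a\<bar> \<le> A" "\<bar>b\<bar> \<le> B" for a b A B :: real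
      using that abs_triangle_ineq[of a b] by (subst abs_divide) simp
    ultimately have "\<bar>E (r, r')\<bar> \<le> (cmod (P.phi ((r + r') *\<^sub>R s)) + cmod (P.phi ((r - r') *\<^sub>R s))) / 2"
      by (simp only: abs_integral_cos_le)
    moreover have "ennreal (1 / 2) * (F (r + r') + F (r - r'))
        = ennreal ((cmod (P.phi ((r + r') *\<^sub>R s)) + cmod (P.phi ((r - r') *\<^sub>R s))) / 2)"
      unfolding F_def
      by (subst ennreal_plus[symmetric], simp, simp, subst ennreal_mult[symmetric]) simp_all
    ultimately show ?thesis
      by (simp only: ennreal_leI)
  qed
  \<comment> \<open>For fixed \<open>r\<close> both \<open>r + r'\<close> and \<open>r - r'\<close>
    run once through the whole line, so the bound is the same for all \<open>r\<close>.\<close>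
  have F_line: "(\<integral>\<^sup>+r'. F (r + r') + F (r - r') \<partial>lborel) = 2 * I" for r
  proof -
    have "(\<integral>\<^sup>+r'. F (r' + r) \<partial>lborel) = I" "(\<integral>\<^sup>+r'. F (r - r') \<partial>lborel) = I"
      unfolding I_def by (rule nn_integral_lborel_translate nn_integral_lborel_reflect, simp)+
    then show ?thesis by (simp add: nn_integral_add add.commute[of r] mult_2)
  qed
  have "(\<integral>\<^sup>+v. ennreal ((kernel CARD('d) m (w v))\<^sup>2) \<partial>P) = ennreal (LINT v|P. (kernel CARD('d) m (w v))\<^sup>2)"
    using int_k by (rule nn_integral_eq_integral) simp
  also have "(LINT v|P. (kernel CARD('d) m (w v))\<^sup>2) = c\<^sup>2 * (LINT p|(?D \<Otimes>\<^sub>M ?D). E p)"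
  proof -
    have "(LINT v|P. LINT p|(?D \<Otimes>\<^sub>M ?D). cos (w v * fst p) * cos (w v * snd p)) = (LINT p|(?D \<Otimes>\<^sub>M ?D). E p)"
      unfolding E_def
      by (rule PDD.Fubini_integral[symmetric])
         (intro PDDf.integrable_const_bound[where B = 1] AE_I2, auto simp: abs_mult intro!: mult_le_one)
    then show ?thesis unfolding sq by simp
  qed
  also have "ennreal \<dots> \<le> ennreal (c\<^sup>2) * (\<integral>\<^sup>+p. ennreal \<bar>E p\<bar> \<partial>(?D \<Otimes>\<^sub>M ?D))"
  proof -
    have "ennreal (LINT p|(?D \<Otimes>\<^sub>M ?D). E p) \<le> ennreal \<bar>LINT p|(?D \<Otimes>\<^sub>M ?D). E p\<bar>"
      by (intro ennreal_leI) simp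
    \<comment> \<open>Should \<open>E\<close> fail to be integrable, its Bochner integral is 0 and
      the inequality holds trivially.\<close>
    also have "\<dots> \<le> (\<integral>\<^sup>+p. ennreal \<bar>E p\<bar> \<partial>(?D \<Otimes>\<^sub>M ?D))"
      using integral_norm_bound_ennreal[of "?D \<Otimes>\<^sub>M ?D" E]
      by (cases "integrable (?D \<Otimes>\<^sub>M ?D) E") (simp_all add: not_integrable_integral_eq)
    finally show ?thesis
      by (subst ennreal_mult') (auto intro: mult_left_mono)
  qed
  also have "(\<integral>\<^sup>+p. ennreal \<bar>E p\<bar> \<partial>(?D \<Otimes>\<^sub>M ?D)) \<le> (\<integral>\<^sup>+p. ennreal (1 / 2) * (F (fst p + snd p) + F (fst p - snd p)) \<partial>(?D \<Otimes>\<^sub>M ?D))"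
    by (rule nn_integral_mono) (use E_le in \<open>auto simp: space_pair_measure\<close>)
  also have "\<dots> = (\<integral>\<^sup>+r. \<integral>\<^sup>+r'. ennreal (1 / 2) * (F (r + r') + F (r - r')) \<partial>?D \<partial>?D)"
    by (subst D.nn_integral_fst[symmetric]) simp_all
  \<comment> \<open>Each radial weight costs a factor \<open>q\<close>. The inner integral is
    extended to the whole line and becomes free of \<open>m\<close>; only the outer one pays the
    length \<open>m\<close>. The total q * q * m is of order m^(2d-1).\<close>
  also have "\<dots> \<le> (\<integral>\<^sup>+r. ennreal q * I \<partial>?D)"
  proof (rule nn_integral_mono)
    fix r
    have "(\<integral>\<^sup>+r'. ennreal (1 / 2) * (F (r + r') + F (r - r')) \<partial>?D)
        \<le> ennreal q * (\<integral>\<^sup>+r'. ennreal (1 / 2) * (F (r + r') + F (r - r')) * indicator {0..m} r' \<partial>lborel)"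
      unfolding q_def by (rule nn_integral_disc_measure_le[OF m]) simp
    also have "\<dots> \<le> ennreal q * (\<integral>\<^sup>+r'. ennreal (1 / 2) * (F (r + r') + F (r - r')) \<partial>lborel)"
      by (intro mult_left_mono nn_integral_mono) (auto split: split_indicator)
    also have "(\<integral>\<^sup>+r'. ennreal (1 / 2) * (F (r + r') + F (r - r')) \<partial>lborel) = ennreal (1 / 2) * (2 * I)"
      by (subst nn_integral_cmult) (simp_all add: F_line)
    also have "\<dots> = I"
    proof -
      have "ennreal (1 / 2) * 2 = ennreal (1 / 2 * 2)"
        by (subst ennreal_mult) simp_all
      then show ?thesis by (simp only: mult.assoc[symmetric]) simp
    qed
    finally show "(\<integral>\<^sup>+r'. ennreal (1 / 2) * (F (r + r') + F (r - r')) \<partial>?D) \<le> ennreal q * I" .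
  qed
  also have "\<dots> \<le> ennreal q * (\<integral>\<^sup>+r. ennreal q * I * indicator {0..m} r \<partial>lborel)"
    unfolding q_def by (rule nn_integral_disc_measure_le[OF m]) simp
  also have "(\<integral>\<^sup>+r. ennreal q * I * indicator {0..m} r \<partial>lborel) = ennreal q * I * ennreal m"
    using m by (subst nn_integral_cmult_indicator) simp_all
  finally have "(\<integral>\<^sup>+v. ennreal ((kernel CARD('d) m (w v))\<^sup>2) \<partial>P) \<le> ennreal (c\<^sup>2) * (ennreal q * (ennreal q * I * ennreal m))"
    by (simp add: mult_left_mono)
  also have "\<dots> = ennreal (c\<^sup>2 * q\<^sup>2 * m) * I"
  proof -
    have "ennreal (c\<^sup>2 * q\<^sup>2 * m) = ennreal (c\<^sup>2) * (ennreal q * (ennreal q * ennreal m))"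
      using q m by (simp add: power2_eq_square[of q] ennreal_mult mult.assoc)
    then show ?thesis by (simp only: mult_ac)
  qed
  finally show ?thesis
    unfolding w_def c_def q_def I_def F_def .
qed

text \<open>The line integrals lack the polar weight r^(d-1). For r > 1 the weight is at least 1 and
  may be inserted; for r \<le> 1 the modulus of \<open>phi\<close> is at most 1, which contributes
  \<open>rho\<close>. The factor 2 accounts for both halves of each line.\<close>

lemma nn_integral_phi_lines:
  "(\<integral>\<^sup>+s. \<integral>\<^sup>+r. ennreal (cmod (P.phi (r *\<^sub>R s))) \<partial>lborel \<partial>sphere_measure)
    \<le> 2 * (ennreal (rho CARD('d)) + (\<integral>\<^sup>+t. ennreal (cmod (P.phi t)) \<partial>lborel))"
proof -
  let ?S = "sphere_measure :: (real^'d) measure" and ?d = "CARD('d)"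
  let ?W = "\<lambda>r::real. ennreal (r ^ (?d - 1)) * indicator {0<..} r"
  have "(\<integral>\<^sup>+s. \<integral>\<^sup>+r. ennreal (cmod (P.phi (r *\<^sub>R s))) \<partial>lborel \<partial>?S)
      = (\<integral>\<^sup>+s. 2 * (\<integral>\<^sup>+r. ennreal (cmod (P.phi (r *\<^sub>R s))) * indicator {0<..} r \<partial>lborel) \<partial>?S)"
    by (intro nn_integral_cong nn_integral_even_line) (simp_all add: cmod_phi_minus)
  also have "\<dots> \<le> (\<integral>\<^sup>+s. 2 * (\<integral>\<^sup>+r. indicator {0<..1} r + ?W r * ennreal (cmod (P.phi (r *\<^sub>R s))) \<partial>lborel) \<partial>?S)"
  proof (intro nn_integral_mono mult_left_mono)
    fix s :: "real^'d" and r :: real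
    have "1 \<le> r ^ (?d - 1)" if "1 < r" using that by (intro one_le_power) simp
    moreover have "ennreal (cmod (P.phi (r *\<^sub>R s))) \<le> 1"
      using ennreal_leI[OF P.norm_phi_le, of "r *\<^sub>R s"] by simp
    ultimately show "ennreal (cmod (P.phi (r *\<^sub>R s))) * indicator {0<..} r
        \<le> indicator {0<..1} r + ?W r * ennreal (cmod (P.phi (r *\<^sub>R s)))"
      by (auto split: split_indicator simp flip: ennreal_mult intro!: ennreal_leI mult_right_mono add_increasing2
          simp: mult_le_cancel_right1)
  qed simp
  also have "\<dots> = (\<integral>\<^sup>+s. 2 * (1 + (\<integral>\<^sup>+r. ?W r * ennreal (cmod (P.phi (r *\<^sub>R s))) \<partial>lborel)) \<partial>?S)"
    by (subst nn_integral_add) simp_all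
  also have "\<dots> = 2 * (ennreal (rho ?d) + (\<integral>\<^sup>+s. \<integral>\<^sup>+r. ?W r * ennreal (cmod (P.phi (r *\<^sub>R s))) \<partial>lborel \<partial>?S))"
  proof -
    have m: "(\<lambda>s. \<integral>\<^sup>+r. ?W r * ennreal (cmod (P.phi (r *\<^sub>R s))) \<partial>lborel) \<in> borel_measurable ?S"
      by (rule borel_measurable_sphere_measure) simp
    show ?thesis
      using m by (simp add: nn_integral_cmult nn_integral_add space_sphere_measure emeasure_sphere_measure_space)
  qed
  also have "(\<integral>\<^sup>+s. \<integral>\<^sup>+r. ?W r * ennreal (cmod (P.phi (r *\<^sub>R s))) \<partial>lborel \<partial>?S) = (\<integral>\<^sup>+t. ennreal (cmod (P.phi t)) \<partial>lborel)"
    by (rule nn_integral_polar[symmetric]) simp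
  finally show ?thesis .
qed

lemma second_moment_le:
  assumes m: "m \<ge> 0" and I: "(\<integral>\<^sup>+t. ennreal (cmod (P.phi t)) \<partial>lborel) \<le> ennreal I" "I \<ge> 0"
  shows "(LINT p|observation_law f. (kernel CARD('d) m (fst p \<bullet> x - snd p))\<^sup>2)
    \<le> 1 / rho CARD('d) * ((rho CARD('d) / (2 * pi) ^ CARD('d))\<^sup>2 * (m ^ (CARD('d) - 1))\<^sup>2 * m) * (2 * (rho CARD('d) + I))"
proof -
  let ?K = "(rho CARD('d) / (2 * pi) ^ CARD('d))\<^sup>2 * (m ^ (CARD('d) - 1))\<^sup>2 * m" and ?r = "rho CARD('d)"
  note borel_measurable_kernel[OF m, measurable]
  have r: "?r > 0" by (simp add: rho_pos)
  have K: "?K \<ge> 0" using m by simp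
  have "(\<integral>\<^sup>+p. ennreal ((kernel CARD('d) m (fst p \<bullet> x - snd p))\<^sup>2) \<partial>observation_law f)
      = ennreal (1 / ?r) * (\<integral>\<^sup>+s. \<integral>\<^sup>+v. ennreal ((kernel CARD('d) m (s \<bullet> x - v \<bullet> s))\<^sup>2) \<partial>P \<partial>sphere_measure)"
    by (subst nn_integral_observation_law_P) simp_all
  also have "\<dots> \<le> ennreal (1 / ?r) * (\<integral>\<^sup>+s. ennreal ?K * (\<integral>\<^sup>+r. ennreal (cmod (P.phi (r *\<^sub>R s))) \<partial>lborel) \<partial>sphere_measure)"
    by (intro mult_left_mono nn_integral_mono second_moment_line m) simp
  also have "\<dots> = ennreal (1 / ?r) * (ennreal ?K * (\<integral>\<^sup>+s. \<integral>\<^sup>+r. ennreal (cmod (P.phi (r *\<^sub>R s))) \<partial>lborel \<partial>sphere_measure))"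
    by (subst nn_integral_cmult) (intro borel_measurable_sphere_measure, simp_all)
  also have "\<dots> \<le> ennreal (1 / ?r) * (ennreal ?K * (2 * (ennreal ?r + ennreal I)))"
    by (intro mult_left_mono order_trans[OF nn_integral_phi_lines] add_mono I(1)) simp_all
  also have "\<dots> = ennreal (1 / ?r * ?K * (2 * (?r + I)))"
  proof -
    have "ennreal a * (ennreal b * (2 * (ennreal ?r + ennreal I))) = ennreal (a * b * (2 * (?r + I)))"
      if "a \<ge> 0" "b \<ge> 0" for a b
    proof -
      have "2 * (ennreal ?r + ennreal I) = ennreal (2 * (?r + I))"
        using r I(2) by (simp only: ennreal_plus[symmetric] ennreal_mult ennreal_numeral less_imp_le
            zero_le_numeral add_nonneg_nonneg)
      then show ?thesis
        using that r I(2) by (simp only: mult.assoc ennreal_mult[symmetric] less_imp_le mult_nonneg_nonneg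
            add_nonneg_nonneg zero_le_numeral)
    qed
    then show ?thesis using r K by simp
  qed
  finally show ?thesis
    using r K I(2)
    by (subst integral_eq_nn_integral) (auto intro!: enn2real_leI borel_measurable_observation_law)
qed

end

section \<open>Mean squared error\<close>

text \<open>Additivity of the variance by integrating out one coordinate at a time: the new variable
  has mean 0, so its cross term with the rest disappears. Boundedness provides every integrability
  condition.\<close>

lemma (in prob_space) integral_PiM_sum_square:
  fixes Y :: "'a \<Rightarrow> real"
  assumes [measurable]: "Y \<in> borel_measurable M" and bound: "\<And>x. \<bar>Y x\<bar> \<le> B"
    and mean: "expectation Y = 0" and "finite I"
  shows "(LINT \<omega>|(\<Pi>\<^sub>M i\<in>I. M). (a + (\<Sum>i\<in>I. Y (\<omega> i)))\<^sup>2) = a\<^sup>2 + real (card I) * expectation (\<lambda>x. (Y x)\<^sup>2)"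
  using \<open>finite I\<close>
proof (induction I arbitrary: a rule: finite_induct)
  case empty
  show ?case by (simp add: PiM_empty lebesgue_integral_count_space_finite)
next
  case (insert j I)
  interpret Q: product_sigma_finite "\<lambda>_. M" by standard
  have B: "0 \<le> B" using bound[of undefined] by linarith
  have sum_le: "\<bar>\<Sum>i\<in>J. Y (\<omega> i)\<bar> \<le> real (card J) * B" for J and \<omega> :: "'b \<Rightarrow> 'a"
    by (rule order_trans[OF sum_abs]) (rule sum_bounded_above, rule bound)
  have intY: "integrable M Y" "integrable M (\<lambda>x. (Y x)\<^sup>2)"
    using bound power_mono[OF bound abs_ge_zero, of _ 2]
    by (simp_all add: integrable_const_bound[where B = B] integrable_const_bound[where B = "B\<^sup>2"])
  have int: "integrable (Pi\<^sub>M J (\<lambda>_. M)) (\<lambda>\<omega>. (a + (\<Sum>i\<in>J. Y (\<omega> i)))\<^sup>2)" if "finite J" for J :: "'b set" and a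
  proof -
    interpret J: prob_space "Pi\<^sub>M J (\<lambda>_. M)" by (rule prob_space_PiM) (rule prob_space_axioms)
    have "\<bar>a + (\<Sum>i\<in>J. Y (\<omega> i))\<bar> \<le> \<bar>a\<bar> + real (card J) * B" for \<omega>
      using sum_le[of \<omega> J] by linarith
    from power_mono[OF this abs_ge_zero, of _ 2] show ?thesis
      by (intro J.integrable_const_bound[where B = "(\<bar>a\<bar> + real (card J) * B)\<^sup>2"]) auto
  qed
  have "(LINT \<omega>|(\<Pi>\<^sub>M i\<in>insert j I. M). (a + (\<Sum>i\<in>insert j I. Y (\<omega> i)))\<^sup>2)
      = (LINT \<omega>|(\<Pi>\<^sub>M i\<in>I. M). LINT x|M. (a + (\<Sum>i\<in>insert j I. Y (fun_upd \<omega> j x i)))\<^sup>2)"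
    by (rule Q.product_integral_insert[OF insert(1,2) int]) (use insert in simp)
  also have "\<dots> = (LINT \<omega>|(\<Pi>\<^sub>M i\<in>I. M). (a + (\<Sum>i\<in>I. Y (\<omega> i)))\<^sup>2 + expectation (\<lambda>x. (Y x)\<^sup>2))"
  proof (rule Bochner_Integration.integral_cong[OF refl])
    fix \<omega> :: "'b \<Rightarrow> 'a"
    define S where "S = a + (\<Sum>i\<in>I. Y (\<omega> i))"
    have "(\<Sum>i\<in>I. Y (fun_upd \<omega> j x i)) = (\<Sum>i\<in>I. Y (\<omega> i))" for x
      using insert by (intro sum.cong) auto
    then have "(a + (\<Sum>i\<in>insert j I. Y (fun_upd \<omega> j x i)))\<^sup>2 = S\<^sup>2 + (2 * S * Y x + (Y x)\<^sup>2)" for x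
      using insert by (simp add: S_def power2_eq_square algebra_simps)
    then show "(LINT x|M. (a + (\<Sum>i\<in>insert j I. Y (fun_upd \<omega> j x i)))\<^sup>2)
        = (a + (\<Sum>i\<in>I. Y (\<omega> i)))\<^sup>2 + expectation (\<lambda>x. (Y x)\<^sup>2)"
      using intY mean by (simp add: prob_space S_def)
  qed
  also have "\<dots> = a\<^sup>2 + real (card I) * expectation (\<lambda>x. (Y x)\<^sup>2) + expectation (\<lambda>x. (Y x)\<^sup>2)"
  proof -
    interpret I: prob_space "Pi\<^sub>M I (\<lambda>_. M)" by (rule prob_space_PiM) (rule prob_space_axioms)
    show ?thesis
      using insert int[OF insert(1)] by (simp add: I.prob_space)
  qed
  finally show ?case
    using insert by (simp add: algebra_simps)
qed

text \<open>The bias-variance decomposition, with the variance enlarged to the second moment, for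
  which an estimate is available.\<close>

lemma (in prob_space) nn_integral_PiM_mean_square_error:
  fixes k :: "'a \<Rightarrow> real"
  assumes [measurable]: "k \<in> borel_measurable M" and bound: "\<And>x. \<bar>k x\<bar> \<le> B" and "n \<ge> 1"
  shows "(\<integral>\<^sup>+\<omega>. ennreal (\<bar>1 / real n * (\<Sum>i=1..n. k (\<omega> i)) - c\<bar>\<^sup>2) \<partial>(\<Pi>\<^sub>M i\<in>{1..n}. M))
    \<le> ennreal (expectation (\<lambda>x. (k x)\<^sup>2) / real n + (expectation k - c)\<^sup>2)"
proof -
  interpret P: prob_space "\<Pi>\<^sub>M i\<in>{1..n}. M" by (rule prob_space_PiM) (rule prob_space_axioms)
  define \<mu> where "\<mu> = expectation k"
  define Y where "Y x = k x - \<mu>" for x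
  have [measurable]: "Y \<in> borel_measurable M" unfolding Y_def by measurable
  have int_k: "integrable M k" "integrable M (\<lambda>x. (k x)\<^sup>2)"
    using bound power_mono[OF bound abs_ge_zero, of _ 2]
    by (simp_all add: integrable_const_bound[where B = B] integrable_const_bound[where B = "B\<^sup>2"])
  have Yb: "\<bar>Y x\<bar> \<le> B + \<bar>\<mu>\<bar>" for x
    using bound[of x] by (simp add: Y_def)
  have Y0: "expectation Y = 0"
    using int_k by (simp add: Y_def[abs_def] \<mu>_def prob_space)
  have Y2: "expectation (\<lambda>x. (Y x)\<^sup>2) \<le> expectation (\<lambda>x. (k x)\<^sup>2)"
    unfolding Y_def \<mu>_def using variance_eq[OF int_k] by simp
  have n: "real n > 0" using \<open>n \<ge> 1\<close> by simp
  \<comment> \<open>Scaling by n separates the error into the deterministic offset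
    \<open>real n * (\<mu> - c)\<close> and a sum of centred variables, the form handled by
    \<open>integral_PiM_sum_square\<close>.\<close>
  have eq: "\<bar>1 / real n * (\<Sum>i=1..n. k (\<omega> i)) - c\<bar>\<^sup>2
      = (1 / (real n)\<^sup>2) * (real n * (\<mu> - c) + (\<Sum>i\<in>{1..n}. Y (\<omega> i)))\<^sup>2" for \<omega>
  proof -
    have "1 / real n * (\<Sum>i=1..n. k (\<omega> i)) - c = (1 / real n) * (real n * (\<mu> - c) + (\<Sum>i\<in>{1..n}. Y (\<omega> i)))"
      using n by (simp add: Y_def sum_subtractf field_simps)
    then show ?thesis by (simp add: power_mult_distrib power_divide)
  qed
  have "\<bar>\<Sum>i\<in>{1..n}. Y (\<omega> i)\<bar> \<le> real n * (B + \<bar>\<mu>\<bar>)" for \<omega> :: "nat \<Rightarrow> 'a"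
    by (rule order_trans[OF sum_abs]) (use sum_bounded_above[of "{1..n}" "\<lambda>i. \<bar>Y (\<omega> i)\<bar>", OF Yb] in simp)
  then have "\<bar>real n * (\<mu> - c) + (\<Sum>i\<in>{1..n}. Y (\<omega> i))\<bar> \<le> \<bar>real n * (\<mu> - c)\<bar> + real n * (B + \<bar>\<mu>\<bar>)" for \<omega> :: "nat \<Rightarrow> 'a"
    by (intro order_trans[OF abs_triangle_ineq] add_mono order_refl)
  from power_mono[OF this abs_ge_zero, of _ 2]
  have int: "integrable (\<Pi>\<^sub>M i\<in>{1..n}. M) (\<lambda>\<omega>. (real n * (\<mu> - c) + (\<Sum>i\<in>{1..n}. Y (\<omega> i)))\<^sup>2)"
    by (intro P.integrable_const_bound[where B = "(\<bar>real n * (\<mu> - c)\<bar> + real n * (B + \<bar>\<mu>\<bar>))\<^sup>2"]) auto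
  have "(\<integral>\<^sup>+\<omega>. ennreal (\<bar>1 / real n * (\<Sum>i=1..n. k (\<omega> i)) - c\<bar>\<^sup>2) \<partial>(\<Pi>\<^sub>M i\<in>{1..n}. M))
      = ennreal (LINT \<omega>|(\<Pi>\<^sub>M i\<in>{1..n}. M). (1 / (real n)\<^sup>2) * (real n * (\<mu> - c) + (\<Sum>i\<in>{1..n}. Y (\<omega> i)))\<^sup>2)"
    unfolding eq using int by (intro nn_integral_eq_integral) auto
  also have "(LINT \<omega>|(\<Pi>\<^sub>M i\<in>{1..n}. M). (1 / (real n)\<^sup>2) * (real n * (\<mu> - c) + (\<Sum>i\<in>{1..n}. Y (\<omega> i)))\<^sup>2)
      = (1 / (real n)\<^sup>2) * ((real n * (\<mu> - c))\<^sup>2 + real n * expectation (\<lambda>x. (Y x)\<^sup>2))"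
    using integral_PiM_sum_square[OF _ Yb Y0, of "{1..n}" "real n * (\<mu> - c)"] by simp
  also have "\<dots> = expectation (\<lambda>x. (Y x)\<^sup>2) / real n + (\<mu> - c)\<^sup>2"
    using n by (simp add: field_simps power2_eq_square)
  also have "ennreal \<dots> \<le> ennreal (expectation (\<lambda>x. (k x)\<^sup>2) / real n + (\<mu> - c)\<^sup>2)"
    using Y2 n by (intro ennreal_leI add_mono divide_right_mono) auto
  finally show ?thesis unfolding \<mu>_def .
qed

section \<open>Balancing bias and variance\<close>

theorem corollary2p1:
  fixes \<beta> L :: real
  assumes "CARD('d::finite) \<ge> 2"
    and "\<beta> > real CARD('d) / 2"
    and "L > 0"
  shows "\<exists>C>0. \<forall>n\<ge>1. \<forall>x :: real ^ 'd.
    (SUP f \<in> {f. prob_density f \<and> (\<lambda>y. complex_of_real (f y)) \<in> sobolev_ellipsoid \<beta> L}.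
        mse n (real n powr (1 / (2 * \<beta> + real CARD('d) - 1))) x f)
    \<le> ennreal (C * real n powr (- ((2 * \<beta> - real CARD('d)) / (2 * \<beta> + real CARD('d) - 1))))"
proof -
  let ?d = "CARD('d)" and ?rho = "rho CARD('d)"
  \<comment> \<open>\<open>p\<close> is the decay exponent of the squared bias. Since D - p = 2d - 1
    is the growth exponent of the second moment, m = n^(1/D) makes the two terms equal in
    order.\<close>
  define p where "p = 2 * \<beta> - real ?d"
  define D where "D = 2 * \<beta> + real ?d - 1"
  have d1: "1 \<le> ?d" using assms(1) by simp
  have p: "p > 0" using assms(2) by (simp add: p_def)
  have D: "D > 0" using assms(1,2) by (simp add: D_def field_simps)
  have r: "?rho > 0" by (simp add: rho_pos)
  obtain J where J: "J > 0" "(\<integral>\<^sup>+t. ennreal (1 / (1 + (norm (t::real^'d))\<^sup>2) powr \<beta>) \<partial>lborel) \<le> ennreal J"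
    by (rule nn_integral_bessel_finite[OF assms(2)])
  define I where "I = sqrt (L * J)"
  have I: "I \<ge> 0" using J(1) assms(3) by (simp add: I_def)
  \<comment> \<open>\<open>A\<close> collects the constants of the second moment, with
    \<open>I\<close> bounding the integral of the modulus of \<open>phi\<close>; \<open>A'\<close>
    collects those of the squared bias. Neither involves n, x or f.\<close>
  define A where "A = 1 / ?rho * (?rho / (2 * pi) ^ ?d)\<^sup>2 * (2 * (?rho + I))"
  define A' where "A' = L * ?rho / p / ((2 * pi) ^ ?d)\<^sup>2"
  have A: "A > 0" using r I by (simp add: A_def)
  have A': "A' > 0" using r p assms(3) by (simp add: A'_def)
  have main: "mse n (real n powr (1 / D)) x f \<le> ennreal ((A + A') * real n powr (- (p / D)))"
    if n: "n \<ge> 1" and f: "prob_density f" and sob: "(\<lambda>y. complex_of_real (f y)) \<in> sobolev_ellipsoid \<beta> L"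
    for n and x :: "real^'d" and f
  proof -
    interpret radon_density f by standard (rule f)
    define m where "m = real n powr (1 / D)"
    have m1: "m > 0" using n by (simp add: m_def)
    define w where "w t = (1 + (norm t)\<^sup>2) powr \<beta>" for t :: "real^'d"
    have w: "w t > 0" for t by (simp add: w_def add_pos_nonneg less_imp_neq[symmetric])
    have [measurable]: "w \<in> borel_measurable borel" unfolding w_def by measurable
    have wL: "(\<integral>\<^sup>+t. ennreal (w t * (cmod (P.phi t))\<^sup>2) \<partial>lborel) \<le> ennreal L"
      using sobolev_ellipsoid_prob_density[OF f sob] by (simp add: fourier_eq_phi w_def)
    have total: "(\<integral>\<^sup>+t. ennreal (cmod (P.phi t)) \<partial>lborel) \<le> ennreal I"
      using nn_integral_weighted_Cauchy_Schwarz[where A = UNIV, OF _ _ _ w wL assms(3) _ J(1)] J(2)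
      by (simp add: w_def I_def)
    define T where "T = sqrt (L * (?rho * (m powr (- p) / p)))"
    have tail: "(\<integral>\<^sup>+t. ennreal (cmod (P.phi t)) * indicator {t. m < norm t} t \<partial>lborel) \<le> ennreal T"
      unfolding T_def
    proof (rule nn_integral_weighted_Cauchy_Schwarz[where w = w])
      show "(\<integral>\<^sup>+t. ennreal (1 / w t) * indicator {t. m < norm t} t \<partial>lborel) \<le> ennreal (?rho * (m powr (- p) / p))"
        using nn_integral_bessel_tail[OF assms(2) m1] by (simp add: w_def p_def)
    qed (use r m1 p w wL assms(3) in simp_all)
    \<comment> \<open>Finiteness of the total integral makes the inversion and bias results
      available.\<close>
    have phi_int: "integrable lborel P.phi"
      unfolding integrable_iff_bounded using total by (auto intro: le_less_trans)
    have k_meas: "(\<lambda>q. kernel ?d m (fst q \<bullet> x - snd q)) \<in> borel_measurable (observation_law f)"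
      using borel_measurable_kernel[of m ?d] m1 by (intro borel_measurable_observation_law) simp
    obtain B where B: "\<And>u. \<bar>kernel ?d m u\<bar> \<le> B" using kernel_bounded[of m ?d] m1 by auto
    interpret Q: prob_space "observation_law f" by (rule prob_space_observation_law[OF f])
    have "mse n m x f \<le> ennreal ((LINT q|observation_law f. (kernel ?d m (fst q \<bullet> x - snd q))\<^sup>2) / real n
        + ((LINT q|observation_law f. kernel ?d m (fst q \<bullet> x - snd q)) - P.inv_phi x)\<^sup>2)"
      unfolding mse_def estimator_def continuous_version_eq[OF phi_int]
      by (rule Q.nn_integral_PiM_mean_square_error[OF k_meas B n])
    also have "\<dots> \<le> ennreal ((A + A') * m powr (- p))"
    proof (intro ennreal_leI)
      have "(LINT q|observation_law f. (kernel ?d m (fst q \<bullet> x - snd q))\<^sup>2) / real n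
          \<le> 1 / ?rho * ((?rho / (2 * pi) ^ ?d)\<^sup>2 * (m ^ (?d - 1))\<^sup>2 * m) * (2 * (?rho + I)) / real n"
        using second_moment_le[OF _ total I, of m x] m1 by (intro divide_right_mono) auto
      also have "\<dots> = A * ((m ^ (?d - 1))\<^sup>2 * m / real n)"
        by (simp add: A_def)
      \<comment> \<open>By the choice of the cutoff n = m^D, so m^(2d-1) / n = m^(2d-1-D) = m^(-p),
        the order of the squared bias.\<close>
      also have "(m ^ (?d - 1))\<^sup>2 * m / real n = m powr (- p)"
      proof -
        have "m ^ (?d - 1) = m powr (real ?d - 1)"
          using powr_realpow[OF m1, of "?d - 1"] d1 by (simp add: of_nat_diff)
        moreover have "m powr D = real n"
          using n D by (simp add: m_def powr_powr)
        ultimately have "(m ^ (?d - 1))\<^sup>2 * m / real n = m powr (real ?d - 1) * m powr (real ?d - 1) * m powr 1 * m powr (- D)"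
          using m1 by (simp add: power2_eq_square powr_minus divide_inverse)
        also have "\<dots> = m powr (- p)"
          unfolding powr_add[symmetric] by (simp add: p_def D_def)
        finally show ?thesis .
      qed
      finally have var: "(LINT q|observation_law f. (kernel ?d m (fst q \<bullet> x - snd q))\<^sup>2) / real n \<le> A * m powr (- p)" .
      have T0: "T \<ge> 0" using r p assms(3) by (simp add: T_def)
      have "\<bar>(LINT q|observation_law f. kernel ?d m (fst q \<bullet> x - snd q)) - P.inv_phi x\<bar> \<le> T / (2 * pi) ^ ?d"
        using bias_le[OF phi_int _ tail T0] m1 by simp
      from power_mono[OF this abs_ge_zero, of 2]
      have "((LINT q|observation_law f. kernel ?d m (fst q \<bullet> x - snd q)) - P.inv_phi x)\<^sup>2 \<le> T\<^sup>2 / ((2 * pi) ^ ?d)\<^sup>2"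
        by (simp only: power2_abs power_divide)
      also have "T\<^sup>2 = L * (?rho * (m powr (- p) / p))"
        unfolding T_def using r p assms(3) by (intro real_sqrt_pow2) simp
      also have "L * (?rho * (m powr (- p) / p)) / ((2 * pi) ^ ?d)\<^sup>2 = A' * m powr (- p)"
        by (simp add: A'_def)
      finally show "(LINT q|observation_law f. (kernel ?d m (fst q \<bullet> x - snd q))\<^sup>2) / real n
          + ((LINT q|observation_law f. kernel ?d m (fst q \<bullet> x - snd q)) - P.inv_phi x)\<^sup>2 \<le> (A + A') * m powr (- p)"
        using var by (simp add: distrib_right)
    qed
    also have "m powr (- p) = real n powr (- (p / D))"
      by (simp add: m_def powr_powr)
    finally show ?thesis unfolding m_def .
  qed
  show ?thesis
    using A A' main by (intro exI[of _ "A + A'"] conjI allI impI SUP_least) (auto simp: p_def D_def)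
qed

end
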